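(* Let $n\ge 1$. Let $P_1(u),\dots,P_{n-1}(u)$ be monic polynomials in $u$ with complex coefficients and let $A_n(u)\in 1+u^{-1}\mathbb{C}[[u^{-1}]]$. Let $\Psi$ be the irreducible finite-dimensional $\mathrm{Y}(\mathfrak{gl}_n)$-module determined (uniquely up to isomorphism) by $A_n(u)$ and $P_1(u),\dots,P_{n-1}(u)$. Then: (a) $\Psi$ is polynomial if and only if $A_n(u)=\dfrac{Q_n(u+1)}{Q_n(u)}$ for some (nonzero) polynomial $Q_n(u)$ in $u$ with complex coefficients; (b) $\Psi$ is rational if and only if $A_n(u)=\dfrac{Q_n(u+1)}{Q_n(u)}$ for some (nonzero) rational function $Q_n(u)$ in $u$ with complex coefficients. Here $Q_n(u+1)/Q_n(u)$ is expanded as a power series in $u^{-1}$.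
   Context: **The Yangian.** $\mathrm{Y}(\mathfrak{gl}_n)$ is the complex unital associative algebra with generators $T_{ij}^{(r)}$, $r\ge1$, $1\le i,j\le n$, and relations $$(u-v)[T_{ij}(u),T_{kl}(v)]=T_{kj}(u)T_{il}(v)-T_{kj}(v)T_{il}(u),$$ where $T_{ij}(u)=\delta_{ij}+T^{(1)}_{ij}u^{-1}+T^{(2)}_{ij}u^{-2}+\cdots$. Tensor products of modules are formed with the comultiplication $T_{ij}(u)\mapsto\sum_{k=1}^n T_{ik}(u)\otimes T_{kj}(u)$; the trivial module is the one-dimensional module where $T_{ij}(u)$ acts as $\delta_{ij}$. **Vector and covector modules.** For $z\in\mathbb{C}$ the vector module $\Phi^1_z$ and the covector module $\Phi^{-1}_z$ both have underlying space $\mathbb{C}^n$ with standard basis $e_1,\dots,e_n$ and action $$T_{ij}(u)e_k=\delta_{ij}e_k+\frac{\delta_{jk}e_i}{u-z}\ \text{ in }\Phi^1_z,\qquad T_{ij}(u)e_k=\delta_{ij}e_k-\frac{\delta_{ik}e_j}{u-z+1}\ \text{ in }\Phi^{-1}_z$$ (expanded in $u^{-1}$). A $\mathrm{Y}(\mathfrak{gl}_n)$-module is *polynomial* if it is isomorphic to a subquotient of a tensor product of finitely many vector modules, and *rational* if it is isomorphic to a subquotient of a tensor product of finitely many vector and covector modules (parameters $z$ arbitrary). The empty tensor product is allowed and is the trivial module. **Classification of irreducibles (known).** Every irreducible finite-dimensional $\mathrm{Y}(\mathfrak{gl}_n)$-module $\Psi$ contains a nonzero vector $v$, unique up to a scalar,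 such that $T_{ij}(u)v=0$ for all $i<j$. It satisfies $T_{ii}(u)v=A_i(u)v$ with $A_i(u)\in1+u^{-1}\mathbb{C}[[u^{-1}]]$ for $i=1,\dots,n$, and there are monic polynomials $P_1(u),\dots,P_{n-1}(u)$ with $$\frac{A_i(u)}{A_{i+1}(u)}=\frac{P_i(u+1)}{P_i(u)}\qquad(1\le i<n).$$ The series $A_1(u),\dots,A_n(u)$ determine $\Psi$ up to isomorphism, and every sequence of series with leading term $1$ satisfying these relations for some monic $P_1,\dots,P_{n-1}$ occurs. Hence $\Psi$ is determined by $A_n(u)$ (arbitrary with leading term $1$) and $P_1(u),\dots,P_{n-1}(u)$ (arbitrary monic). *)

theory Defs
  imports
    Complex_Main
    "HOL-Computational_Algebra.Computational_Algebra"
    "HOL-Computational_Algebra.Field_as_Ring"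
    "HOL-Library.Function_Algebras"
    "HOL-Library.Set_Algebras"
begin

section \<open>Modules over the Yangian of gl(n)\<close>

text \<open>
  A module over the algebra presented by the generators \<open>T_ij^(r)\<close> is a complex vector space
  with a family of operators satisfying the defining relations.  The vector space is a subspace \<open>V\<close>
  of an ambient space (so submodules and tensor products of any dimension fit), and
  \<open>T i j r\<close> is the operator by which the coefficient of \<open>u^(-r)\<close> in \<open>T_ij(u)\<close> acts;
  indices run over \<open>{1..n}\<close> and the action is only constrained there and on \<open>V\<close>.
  The coefficient for \<open>r = 0\<close> is the Kronecker delta.  The last assumption is the coefficient of
  \<open>u^(-r) v^(-s)\<close> in
  \<open>(u - v) [T_ij(u), T_kl(v)] = T_kj(u) T_il(v) - T_kj(v) T_il(u)\<close>;
  the coefficients of \<open>u v^(-s)\<close> and \<open>u^(-r) v\<close> vanish on both sides, since the constant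
  terms of the series are scalars.
\<close>

type_synonym 'v action = "nat \<Rightarrow> nat \<Rightarrow> nat \<Rightarrow> 'v \<Rightarrow> 'v"

locale yangian_module = vector_space scale
  for scale :: "complex \<Rightarrow> 'v::ab_group_add \<Rightarrow> 'v" +
  fixes n :: nat and V :: "'v set" and T :: "'v action"
  assumes subspace_V: "subspace V"
    and T_closed:
      "\<lbrakk>i \<in> {1..n}; j \<in> {1..n}; x \<in> V\<rbrakk> \<Longrightarrow> T i j r x \<in> V"
    and T_add:
      "\<lbrakk>i \<in> {1..n}; j \<in> {1..n}; x \<in> V; y \<in> V\<rbrakk> \<Longrightarrow> T i j r (x + y) = T i j r x + T i j r y"
    and T_scale:
      "\<lbrakk>i \<in> {1..n}; j \<in> {1..n}; x \<in> V\<rbrakk> \<Longrightarrow> T i j r (scale c x) = scale c (T i j r x)"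
    and T_zeroth:
      "\<lbrakk>i \<in> {1..n}; j \<in> {1..n}; x \<in> V\<rbrakk> \<Longrightarrow> T i j 0 x = (if i = j then x else 0)"
    and T_relation:
      "\<lbrakk>i \<in> {1..n}; j \<in> {1..n}; k \<in> {1..n}; l \<in> {1..n}; x \<in> V\<rbrakk> \<Longrightarrow>
         (T i j (Suc r) (T k l s x) - T k l s (T i j (Suc r) x))
         - (T i j r (T k l (Suc s) x) - T k l (Suc s) (T i j r x))
         = T k j r (T i l s x) - T k j s (T i l r x)"

definition yangian_submodule ::
  "(complex \<Rightarrow> 'v::ab_group_add \<Rightarrow> 'v) \<Rightarrow> nat \<Rightarrow> 'v set \<Rightarrow> 'v action \<Rightarrow> 'v set \<Rightarrow> bool" where
  "yangian_submodule scale n V T W \<longleftrightarrow>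
     W \<subseteq> V \<and> module.subspace scale W \<and>
     (\<forall>i\<in>{1..n}. \<forall>j\<in>{1..n}. \<forall>r. \<forall>x\<in>W. T i j r x \<in> W)"

definition irreducible_fin_dim_module ::
  "(complex \<Rightarrow> 'v::ab_group_add \<Rightarrow> 'v) \<Rightarrow> nat \<Rightarrow> 'v set \<Rightarrow> 'v action \<Rightarrow> bool" where
  "irreducible_fin_dim_module scale n V T \<longleftrightarrow>
     yangian_module scale n V T \<and>
     (\<exists>B. finite B \<and> module.span scale B = V) \<and>
     V \<noteq> {0} \<and>
     (\<forall>W. yangian_submodule scale n V T W \<longrightarrow> W = {0} \<or> W = V)"

text \<open>
  \<open>M / N\<close> is the set of cosets \<open>x +o N\<close> with the operations induced on representatives;
  \<open>\<phi>\<close> is an isomorphism from it onto the module \<open>V'\<close>.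
\<close>

definition isomorphic_to_quotient ::
  "nat \<Rightarrow> (complex \<Rightarrow> 'a::ab_group_add \<Rightarrow> 'a) \<Rightarrow> 'a set \<Rightarrow> 'a set \<Rightarrow> 'a action \<Rightarrow>
     (complex \<Rightarrow> 'v::ab_group_add \<Rightarrow> 'v) \<Rightarrow> 'v set \<Rightarrow> 'v action \<Rightarrow> bool" where
  "isomorphic_to_quotient n scale M N T scale' V' T' \<longleftrightarrow>
     (\<exists>\<phi> :: 'a set \<Rightarrow> 'v.
        bij_betw \<phi> ((\<lambda>x. x +o N) ` M) V' \<and>
        (\<forall>x\<in>M. \<forall>y\<in>M. \<phi> ((x + y) +o N) = \<phi> (x +o N) + \<phi> (y +o N)) \<and>
        (\<forall>c. \<forall>x\<in>M. \<phi> (scale c x +o N) = scale' c (\<phi> (x +o N))) \<and>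
        (\<forall>i\<in>{1..n}. \<forall>j\<in>{1..n}. \<forall>r. \<forall>x\<in>M.
           \<phi> (T i j r x +o N) = T' i j r (\<phi> (x +o N))))"

definition isomorphic_to_subquotient ::
  "nat \<Rightarrow> (complex \<Rightarrow> 'a::ab_group_add \<Rightarrow> 'a) \<Rightarrow> 'a set \<Rightarrow> 'a action \<Rightarrow>
     (complex \<Rightarrow> 'v::ab_group_add \<Rightarrow> 'v) \<Rightarrow> 'v set \<Rightarrow> 'v action \<Rightarrow> bool" where
  "isomorphic_to_subquotient n scale V T scale' V' T' \<longleftrightarrow>
     (\<exists>M N. yangian_submodule scale n V T M \<and> yangian_submodule scale n V T N \<and> N \<subseteq> M \<and>
        isomorphic_to_quotient n scale M N T scale' V' T')"

section \<open>Tensor products of vector and covector modules\<close>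

text \<open>
  Power series in \<open>u^(-1)\<close> are formal power series with \<open>fps_X\<close> in the role of
  \<open>u^(-1)\<close>; thus \<open>1/(u - z) = u^(-1) / (1 - z u^(-1))\<close>.
\<close>

definition recip_series :: "complex \<Rightarrow> complex fps" where
  "recip_series z = fps_X * inverse (1 - fps_const z * fps_X)"

datatype factor = Vector complex | Covector complex

text \<open>
  \<open>factor_series F i j b a\<close> is the coefficient of \<open>e_b\<close> in \<open>T_ij(u) e_a\<close>.
  For \<open>Covector z\<close> the denominator is \<open>u - z + 1 = u - (z - 1)\<close>.
\<close>

fun factor_series :: "factor \<Rightarrow> nat \<Rightarrow> nat \<Rightarrow> nat \<Rightarrow> nat \<Rightarrow> complex fps" where
  "factor_series (Vector z) i j b a =
     (if i = j \<and> b = a then 1 else 0) + (if j = a \<and> b = i then recip_series z else 0)"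
| "factor_series (Covector z) i j b a =
     (if i = j \<and> b = a then 1 else 0) - (if i = a \<and> b = j then recip_series (z - 1) else 0)"

text \<open>
  The tensor product of \<open>m\<close> copies of \<open>C^n\<close> has the basis \<open>e_w = e_(w_1) \<otimes> ... \<otimes> e_(w_m)\<close>
  indexed by words \<open>w\<close>; a vector is the function giving its coordinates.
  \<open>tensor_series n Fs i j w' w\<close> is the coefficient of \<open>e_w'\<close> in \<open>T_ij(u) e_w\<close>, where
  \<open>T_ij(u)\<close> acts through the comultiplication
  \<open>T_ij(u) \<mapsto> sum over k of T_ik(u) \<otimes> T_kj(u)\<close>, and trivially on the empty product.
\<close>

primrec tensor_series ::
  "nat \<Rightarrow> factor list \<Rightarrow> nat \<Rightarrow> nat \<Rightarrow> nat list \<Rightarrow> nat list \<Rightarrow> complex fps" where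
  "tensor_series n [] = (\<lambda>i j w' w. if i = j then 1 else 0)"
| "tensor_series n (F # Fs) = (\<lambda>i j w' w.
     \<Sum>k\<in>{1..n}. factor_series F i k (hd w') (hd w) * tensor_series n Fs k j (tl w') (tl w))"

definition words :: "nat \<Rightarrow> nat \<Rightarrow> nat list set" where
  "words n m = {w. length w = m \<and> set w \<subseteq> {1..n}}"

definition fun_scale :: "complex \<Rightarrow> (nat list \<Rightarrow> complex) \<Rightarrow> nat list \<Rightarrow> complex" where
  "fun_scale c f = (\<lambda>w. c * f w)"

definition tensor_space :: "nat \<Rightarrow> factor list \<Rightarrow> (nat list \<Rightarrow> complex) set" where
  "tensor_space n Fs = {f. \<forall>w. w \<notin> words n (length Fs) \<longrightarrow> f w = 0}"

definition tensor_action :: "nat \<Rightarrow> factor list \<Rightarrow> (nat list \<Rightarrow> complex) action" where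
  "tensor_action n Fs i j r f = (\<lambda>w'.
     if w' \<in> words n (length Fs)
     then \<Sum>w\<in>words n (length Fs). fps_nth (tensor_series n Fs i j w' w) r * f w
     else 0)"

definition polynomial_module ::
  "(complex \<Rightarrow> 'v::ab_group_add \<Rightarrow> 'v) \<Rightarrow> nat \<Rightarrow> 'v set \<Rightarrow> 'v action \<Rightarrow> bool" where
  "polynomial_module scale n V T \<longleftrightarrow>
     (\<exists>zs :: complex list. let Fs = map Vector zs in
        isomorphic_to_subquotient n fun_scale (tensor_space n Fs) (tensor_action n Fs) scale V T)"

definition rational_module ::
  "(complex \<Rightarrow> 'v::ab_group_add \<Rightarrow> 'v) \<Rightarrow> nat \<Rightarrow> 'v set \<Rightarrow> 'v action \<Rightarrow> bool" where
  "rational_module scale n V T \<longleftrightarrow>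
     (\<exists>Fs :: factor list.
        isomorphic_to_subquotient n fun_scale (tensor_space n Fs) (tensor_action n Fs) scale V T)"

section \<open>Expansions at infinity and the classification data\<close>

text \<open>
  Laurent series in \<open>u^(-1)\<close>: \<open>fls_X\<close> stands for \<open>u^(-1)\<close>, so a polynomial in \<open>u\<close> is
  expanded by evaluating it at \<open>fls_X_inv\<close>.
\<close>

definition expand_poly :: "complex poly \<Rightarrow> complex fls" where
  "expand_poly p = poly (map_poly fls_const p) fls_X_inv"

definition shift_poly :: "complex poly \<Rightarrow> complex poly" where
  "shift_poly p = pcompose p [:1, 1:]"

definition poly_shift_ratio :: "complex poly \<Rightarrow> complex fls" where
  "poly_shift_ratio Q = expand_poly (shift_poly Q) / expand_poly Q"

definition expand_ratfun :: "complex poly fract \<Rightarrow> complex fls" where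
  "expand_ratfun Q = expand_poly (fst (quot_of_fract Q)) / expand_poly (snd (quot_of_fract Q))"

definition shift_ratfun :: "complex poly fract \<Rightarrow> complex poly fract" where
  "shift_ratfun Q = Fract (shift_poly (fst (quot_of_fract Q))) (shift_poly (snd (quot_of_fract Q)))"

definition ratfun_shift_ratio :: "complex poly fract \<Rightarrow> complex fls" where
  "ratfun_shift_ratio Q = expand_ratfun (shift_ratfun Q) / expand_ratfun Q"

text \<open>
  The irreducible module \<open>V\<close> is the one determined by \<open>A_n(u)\<close> and
  \<open>P_1(u), ..., P_(n-1)(u)\<close> when the eigenvalues \<open>A_1(u), ..., A_n(u)\<close> of the
  \<open>T_ii(u)\<close> on its highest vector have the prescribed \<open>A_n(u)\<close> and the prescribed
  consecutive ratios.
\<close>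

definition determined_by ::
  "(complex \<Rightarrow> 'v::ab_group_add \<Rightarrow> 'v) \<Rightarrow> nat \<Rightarrow> 'v set \<Rightarrow> 'v action \<Rightarrow>
     complex fps \<Rightarrow> (nat \<Rightarrow> complex poly) \<Rightarrow> bool" where
  "determined_by scale n V T An P \<longleftrightarrow>
     (\<exists>v\<in>V. \<exists>A :: nat \<Rightarrow> complex fps.
        v \<noteq> 0 \<and>
        (\<forall>i\<in>{1..n}. \<forall>j\<in>{1..n}. i < j \<longrightarrow> (\<forall>r. T i j r v = 0)) \<and>
        (\<forall>i\<in>{1..n}. fps_nth (A i) 0 = 1 \<and> (\<forall>r. T i i r v = scale (fps_nth (A i) r) v)) \<and>
        A n = An \<and>
        (\<forall>i\<in>{1..<n}. fps_to_fls (A i) / fps_to_fls (A (Suc i)) = poly_shift_ratio (P i)))"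

end

theory Submission
  imports Defs "HOL-Library.Product_Plus"
begin

text \<open>
  Both equivalences are read off from the eigenvalue \<open>A_n(u)\<close> of \<open>T_nn(u)\<close>.

  The conditions are necessary because \<open>T_nn(u)\<close> acts on a tensor product of vector and covector
  modules by a triangular matrix (\<open>tensor_series_triangular\<close>).  Hence an eigenvalue of \<open>T_nn(u)\<close> on a
  subquotient is one of the diagonal entries (\<open>subquotient_eigenvalue\<close>), and these are products of
  factors \<open>(u - z + 1) / (u - z)\<close> from the vector modules and \<open>(u - z) / (u - z + 1)\<close> from the
  covector modules.  With \<open>Q(u) = u - z\<close> these two are \<open>Q(u + 1) / Q(u)\<close> and its inverse.

  The conditions are sufficient because an irreducible module is a subquotient of every module that
  contains a nonzero highest weight vector with the same eigenvalues
  (\<open>irreducible_subquotient_of_hw_module\<close>).  This is the uniqueness part of the highest weight theory,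
  and it rests on a weak form of the triangular decomposition (\<open>cyclic_imp_lowered\<close>).  So suitable
  highest weight vectors must be found in tensor products.  The tensor product of two such vectors
  is another one, and the eigenvalues are multiplied (\<open>weight_vector_tensor\<close>).  After the
  polynomials have been split into linear factors, two kinds of vectors are enough.  Among the
  alternating tensors in \<open>k\<close> vector modules with consecutive parameters there is one for which
  \<open>T_ii(u)\<close> has the eigenvalue \<open>(u - z + 1) / (u - z)\<close> if \<open>i \<le> k\<close> and \<open>1\<close> if \<open>i > k\<close>.  These realize the
  factors of \<open>P_k\<close>, and for \<open>k = n\<close> those of the numerator of \<open>Q_n\<close>.  The alternating tensor in
  \<open>n\<close> covector modules has the eigenvalue \<open>(u - z) / (u - z + 1)\<close> for all \<open>i\<close> and realizes the
  factors of the denominator of \<open>Q_n\<close>.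
\<close>

section \<open>Highest weight modules\<close>

context yangian_module
begin

lemma zero_mem: "0 \<in> V"
  using subspace_0[OF subspace_V] .

lemma add_mem: "x \<in> V \<Longrightarrow> y \<in> V \<Longrightarrow> x + y \<in> V"
  using subspace_add[OF subspace_V] .

lemma scale_mem: "x \<in> V \<Longrightarrow> scale c x \<in> V"
  using subspace_scale[OF subspace_V] .

lemma diff_mem: "x \<in> V \<Longrightarrow> y \<in> V \<Longrightarrow> x - y \<in> V"
  using subspace_diff[OF subspace_V] .

lemma T_zero: "i \<in> {1..n} \<Longrightarrow> j \<in> {1..n} \<Longrightarrow> T i j r 0 = 0"
  using T_scale[of i j 0 r 0] zero_mem by simp

lemma T_diff:
  assumes "i \<in> {1..n}" "j \<in> {1..n}" "x \<in> V" "y \<in> V"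
  shows "T i j r (x - y) = T i j r x - T i j r y"
  using T_add[OF assms(1,2) diff_mem[OF assms(3,4)] assms(4), of r] by (simp add: algebra_simps)

lemma sum_mem: "(\<And>a. a \<in> A \<Longrightarrow> f a \<in> V) \<Longrightarrow> sum f A \<in> V"
  using subspace_sum[OF subspace_V] .

lemma T_sum:
  assumes "i \<in> {1..n}" "j \<in> {1..n}" "\<And>a. a \<in> A \<Longrightarrow> f a \<in> V"
  shows "T i j r (sum f A) = (\<Sum>a\<in>A. T i j r (f a))"
  using assms
  by (induction A rule: infinite_finite_induct) (auto simp: T_zero T_add sum_mem)

text \<open>
  The elements obtained from \<open>v\<close> by linear combinations of words in the operators
  \<open>T_ij^(r)\<close> with \<open>r \<ge> 1\<close> and \<open>R i j\<close>, filtered by the sum of the superscripts \<open>r\<close>.  For this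
  filtration the associated graded algebra of the Yangian is commutative.
\<close>

inductive reach :: "(nat \<Rightarrow> nat \<Rightarrow> bool) \<Rightarrow> 'v \<Rightarrow> nat \<Rightarrow> 'v \<Rightarrow> bool" for R v where
  start: "reach R v d v"
| act: "reach R v d x \<Longrightarrow> i \<in> {1..n} \<Longrightarrow> j \<in> {1..n} \<Longrightarrow> R i j \<Longrightarrow> d + Suc r \<le> e \<Longrightarrow>
    reach R v e (T i j (Suc r) x)"
| add: "reach R v d x \<Longrightarrow> reach R v d y \<Longrightarrow> reach R v d (x + y)"
| scale: "reach R v d x \<Longrightarrow> reach R v d (scale c x)"

lemma reach_mono: "reach R v d x \<Longrightarrow> d \<le> e \<Longrightarrow> reach R v e x"
proof (induction arbitrary: e rule: reach.induct)
  case (act d x i j r e')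
  then show ?case by (intro reach.act[of R v d x i j r e]) auto
qed (auto intro: reach.intros)

lemma reach_mem: "reach R v d x \<Longrightarrow> v \<in> V \<Longrightarrow> x \<in> V"
  by (induction rule: reach.induct) (auto intro: T_closed add_mem scale_mem)

lemma reach_zero: "reach R v d 0"
  using reach.scale[OF reach.start, of R v d 0] by simp

lemma reach_diff: "reach R v d x \<Longrightarrow> reach R v d y \<Longrightarrow> reach R v d (x - y)"
  using reach.add[of R v d x "scale (-1) y"] reach.scale[of R v d y "-1"] by simp

abbreviation cyclic :: "'v \<Rightarrow> nat \<Rightarrow> 'v \<Rightarrow> bool" where
  "cyclic \<equiv> reach (\<lambda>_ _. True)"

abbreviation lowered :: "'v \<Rightarrow> nat \<Rightarrow> 'v \<Rightarrow> bool" where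
  "lowered \<equiv> reach (\<lambda>i j. j < i)"

lemma cyclic_T:
  assumes "cyclic v d x" "v \<in> V" "i \<in> {1..n}" "j \<in> {1..n}"
  shows "cyclic v (d + r) (T i j r x)"
proof (cases r)
  case 0
  then show ?thesis
    using assms T_zeroth[OF assms(3,4) reach_mem[OF assms(1,2)]] by (auto simp: reach_zero)
next
  case (Suc r')
  then show ?thesis using reach.act[OF assms(1,3,4), of r'] by simp
qed

text \<open>
  The defining relation expresses \<open>[T_ij^(r+1), T_kl^(s)]\<close> by \<open>[T_ij^(r), T_kl^(s+1)]\<close> and
  products of total degree \<open>r + s\<close>; as operators with superscript \<open>0\<close> are scalars, iterating it
  shows that a commutator has smaller degree than the product.
\<close>

lemma commutator_degree:
  assumes "cyclic v d x" "v \<in> V"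
    "i \<in> {1..n}" "j \<in> {1..n}" "k \<in> {1..n}" "l \<in> {1..n}"
  shows "cyclic v (d + (r + s - 1)) (T i j r (T k l s x) - T k l s (T i j r x))"
proof (induction r arbitrary: s)
  case 0
  have x: "x \<in> V" using reach_mem assms by blast
  have "T i j 0 (T k l s x) - T k l s (T i j 0 x) = 0"
    using assms x by (simp add: T_zeroth T_closed T_zero)
  then show ?case by (simp add: reach_zero)
next
  case (Suc r)
  have x: "x \<in> V" using reach_mem assms by blast
  have eq: "T i j (Suc r) (T k l s x) - T k l s (T i j (Suc r) x)
      = (T i j r (T k l (Suc s) x) - T k l (Suc s) (T i j r x))
        + (T k j r (T i l s x) - T k j s (T i l r x))"
    using T_relation[OF assms(3-6) x, of r s] by (simp add: algebra_simps)
  have 1: "cyclic v (d + (r + s)) (T k j r (T i l s x))"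
    using cyclic_T[OF cyclic_T[OF assms(1,2,3,6), of s] assms(2,5,4), of r]
    by (simp add: ac_simps)
  have 2: "cyclic v (d + (r + s)) (T k j s (T i l r x))"
    using cyclic_T[OF cyclic_T[OF assms(1,2,3,6), of r] assms(2,5,4), of s]
    by (simp add: ac_simps)
  show ?case
    unfolding eq using reach.add[OF Suc.IH[of "Suc s"]] reach_diff[OF 1 2] by simp
qed

definition hw_vector :: "(nat \<Rightarrow> complex fps) \<Rightarrow> 'v \<Rightarrow> bool" where
  "hw_vector A v \<longleftrightarrow> v \<in> V \<and>
     (\<forall>i\<in>{1..n}. \<forall>j\<in>{1..n}. i < j \<longrightarrow> (\<forall>r. T i j r v = 0)) \<and>
     (\<forall>i\<in>{1..n}. \<forall>r. T i i r v = scale (fps_nth (A i) r) v)"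

text \<open>
  A weak form of the triangular decomposition.  An operator that is not lowering is moved to the
  right through a word of lowering operators until it meets \<open>v\<close>; each exchange costs a commutator,
  which is covered by induction on the degree.
\<close>

lemma cyclic_imp_lowered:
  assumes hw: "hw_vector A v"
  shows "cyclic v d x \<Longrightarrow> lowered v d x"
proof (induction d arbitrary: x rule: less_induct)
  case (less d)
  have v: "v \<in> V" using hw by (simp add: hw_vector_def)
  have low_cyc: "cyclic v e y" if "lowered v e y" for e y
    using that by (induction rule: reach.induct) (auto intro: reach.intros)
  have T_low: "lowered v e (T i j (Suc r) y)"
    if "lowered v e' y" "i \<in> {1..n}" "j \<in> {1..n}" "e' + Suc r \<le> e" "e \<le> d" for e' e i j r y
    using that
  proof (induction arbitrary: e i j r rule: reach.induct)
    case (start e')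
    then show ?case
      using hw reach.act[of "\<lambda>i j. j < i" v e' v i j r e] reach.start[of "\<lambda>i j. j < i" v]
      by (cases i j rule: linorder_cases) (auto simp: hw_vector_def reach_zero reach.scale)
  next
    case (act e1 y k l s e2)
    have y: "y \<in> V" using reach_mem act.hyps(1) v by blast
    have "lowered v (e1 + Suc r) (T i j (Suc r) y)"
      by (rule act.IH) (use act.prems act.hyps in auto)
    then have 1: "lowered v e (T k l (Suc s) (T i j (Suc r) y))"
      by (rule reach.act) (use act.prems act.hyps in auto)
    have "cyclic v (e1 + (Suc r + Suc s - 1))
        (T i j (Suc r) (T k l (Suc s) y) - T k l (Suc s) (T i j (Suc r) y))"
      using commutator_degree[OF low_cyc[OF act.hyps(1)] v] act by blast
    then have "lowered v (e1 + (Suc r + Suc s - 1))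
        (T i j (Suc r) (T k l (Suc s) y) - T k l (Suc s) (T i j (Suc r) y))"
      by (rule less.IH[rotated]) (use act.prems act.hyps in auto)
    then have "lowered v e
        (T i j (Suc r) (T k l (Suc s) y) - T k l (Suc s) (T i j (Suc r) y))"
      by (rule reach_mono) (use act.prems act.hyps in auto)
    from reach.add[OF this 1] show ?case by simp
  next
    case (add e' x y)
    then show ?case
      using reach.add[OF add.IH(1) add.IH(2)] T_add[of i j x y] reach_mem[OF _ v] by auto
  next
    case (scale e' x c)
    then show ?case
      using reach.scale[OF scale.IH] T_scale[of i j x] reach_mem[OF _ v] by auto
  qed
  have "lowered v e y" if "cyclic v e y" "e \<le> d" for e y
    using that
  proof (induction rule: reach.induct)
    case (act e' y i j r e)
    then show ?case by (intro T_low[where e' = e']) auto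
  qed (auto intro: reach.intros)
  then show ?case using less.prems by blast
qed

text \<open>An element of the Cartan subalgebra of \<open>gl(n)\<close> for which every lowering operator has
  positive weight.\<close>

definition height :: "'v \<Rightarrow> 'v" where
  "height x = (\<Sum>i\<in>{1..n}. scale (of_nat i) (T i i (Suc 0) x))"

lemma height_add: "x \<in> V \<Longrightarrow> y \<in> V \<Longrightarrow> height (x + y) = height x + height y"
  by (simp add: height_def T_add scale_right_distrib sum.distrib)

lemma height_scale: "x \<in> V \<Longrightarrow> height (scale c x) = scale c (height x)"
  by (simp add: height_def T_scale scale_sum_right mult.commute)

lemma height_zero: "height 0 = 0"
  by (simp add: height_def T_zero)

lemma height_diff: "x \<in> V \<Longrightarrow> y \<in> V \<Longrightarrow> height (x - y) = height x - height y"
  by (simp add: height_def T_diff scale_right_diff_distrib sum_subtractf)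

lemma height_sum: "(\<And>a. a \<in> A \<Longrightarrow> f a \<in> V) \<Longrightarrow> height (sum f A) = (\<Sum>a\<in>A. height (f a))"
  by (induction A rule: infinite_finite_induct) (auto simp: height_zero height_add sum_mem)

lemma height_T:
  assumes "k \<in> {1..n}" "l \<in> {1..n}" "x \<in> V"
  shows "height (T k l s x) = T k l s (height x) + scale (of_nat k - of_nat l) (T k l s x)"
proof -
  have comm: "T i i (Suc 0) (T k l s x) = T k l s (T i i (Suc 0) x)
      + ((if i = k then T k l s x else 0) - (if i = l then T k l s x else 0))"
    if "i \<in> {1..n}" for i
    using T_relation[OF that that assms, of 0 s] that assms
    by (auto simp: T_zeroth T_closed T_zero algebra_simps)
  have "height (T k l s x) = (\<Sum>i\<in>{1..n}. scale (of_nat i) (T k l s (T i i (Suc 0) x))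
      + ((if i = k then scale (of_nat k) (T k l s x) else 0)
         - (if i = l then scale (of_nat l) (T k l s x) else 0)))"
    unfolding height_def
    by (intro sum.cong refl) (auto simp: comm scale_right_distrib scale_right_diff_distrib)
  also have "\<dots> = (\<Sum>i\<in>{1..n}. scale (of_nat i) (T k l s (T i i (Suc 0) x)))
      + (scale (of_nat k) (T k l s x) - scale (of_nat l) (T k l s x))"
    using assms by (simp add: sum.distrib sum_subtractf)
  also have "(\<Sum>i\<in>{1..n}. scale (of_nat i) (T k l s (T i i (Suc 0) x))) = T k l s (height x)"
  proof -
    have "T k l s (height x) = (\<Sum>i\<in>{1..n}. T k l s (scale (of_nat i) (T i i (Suc 0) x)))"
      unfolding height_def using assms by (intro T_sum scale_mem T_closed) auto
    also have "\<dots> = (\<Sum>i\<in>{1..n}. scale (of_nat i) (T k l s (T i i (Suc 0) x)))"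
      using assms by (intro sum.cong refl T_scale T_closed) auto
    finally show ?thesis ..
  qed
  finally show ?thesis by (simp add: scale_left_diff_distrib)
qed

lemma height_eigenvectors_independent:
  assumes "\<And>d. d \<le> D \<Longrightarrow> c d \<in> V \<and> height (c d) = scale (\<kappa> + of_nat d) (c d)"
    and "(\<Sum>d\<le>D. c d) = 0" and "d \<le> D"
  shows "c d = 0"
  using assms
proof (induction D arbitrary: c d)
  case 0
  then show ?case by simp
next
  case (Suc D)
  define \<mu> where "\<mu> = \<kappa> + of_nat (Suc D)"
  have "0 = height (\<Sum>d\<le>Suc D. c d) - scale \<mu> (\<Sum>d\<le>Suc D. c d)"
    by (simp only: Suc.prems(2) height_zero) simp
  also have "\<dots> = (\<Sum>d\<le>Suc D. scale (\<kappa> + of_nat d) (c d)) - (\<Sum>d\<le>Suc D. scale \<mu> (c d))"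
    using Suc.prems(1) by (subst height_sum) (auto simp: scale_sum_right simp del: sum.atMost_Suc)
  also have "\<dots> = (\<Sum>d\<le>Suc D. scale (of_nat d - of_nat (Suc D)) (c d))"
    by (simp add: sum_subtractf[symmetric] scale_left_diff_distrib[symmetric] \<mu>_def
        del: sum.atMost_Suc of_nat_Suc)
  also have "\<dots> = (\<Sum>d\<le>D. scale (of_nat d - of_nat (Suc D)) (c d))"
    by simp
  finally have sum0: "(\<Sum>d\<le>D. scale (of_nat d - of_nat (Suc D)) (c d)) = 0" by simp
  have low: "c d = 0" if "d \<le> D" for d
  proof -
    have "scale (of_nat d - of_nat (Suc D)) (c d) = 0"
      by (rule Suc.IH[OF _ sum0 that])
        (use Suc.prems(1) in \<open>auto simp: scale_mem height_scale mult.commute simp del: of_nat_Suc\<close>)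
    moreover have "(of_nat d - of_nat (Suc D) :: complex) \<noteq> 0"
      using that by (simp only: right_minus_eq of_nat_eq_iff)
    ultimately show ?thesis by (simp only: scale_eq_0_iff) simp
  qed
  then show ?case using Suc.prems(2,3) by (cases "d = Suc D") auto
qed

text \<open>
  Lowering operators raise the eigenvalue of \<^term>\<open>height\<close> by positive integers, so nothing but
  the multiples of \<open>v\<close> has the eigenvalue of \<open>v\<close> in the module that \<open>v\<close> generates.
\<close>

lemma hw_space_one_dimensional:
  assumes hw: "hw_vector A v" and x: "cyclic v d x"
    and h: "height v = scale \<kappa> v" "height x = scale \<kappa> x"
  shows "\<exists>c. x = scale c v"
proof -
  have v: "v \<in> V" using hw by (simp add: hw_vector_def)
  \<comment> \<open>\<open>c d\<close> is the component of \<open>x\<close> where the eigenvalue is \<open>d\<close> larger than that of \<open>v\<close>.\<close>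
  have "\<exists>D c a. (\<forall>d. c d \<in> V \<and> height (c d) = scale (\<kappa> + of_nat d) (c d) \<and> (d > D \<longrightarrow> c d = 0))
          \<and> c 0 = scale a v \<and> x = (\<Sum>d\<le>D. c d)" (is "\<exists>D c a. ?P D c a x")
    using cyclic_imp_lowered[OF hw x]
  proof (induction rule: reach.induct)
    case (start d)
    show ?case
      by (rule exI[of _ 0], rule exI[of _ "\<lambda>d. if d = 0 then v else 0"], rule exI[of _ 1])
        (auto simp: v zero_mem h height_zero)
  next
    case (act d x i j r e)
    then obtain D c a where c: "?P D c a x" by blast
    define b where "b = i - j"
    have b: "b > 0" "(of_nat i - of_nat j :: complex) = of_nat b"
      using act.hyps by (auto simp: b_def of_nat_diff)
    define c' where "c' = (\<lambda>d. if b \<le> d then T i j (Suc r) (c (d - b)) else 0)"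
    have eig: "height (c' d) = scale (\<kappa> + of_nat d) (c' d)" for d
    proof (cases "b \<le> d")
      case True
      have "height (T i j (Suc r) (c (d - b))) = T i j (Suc r) (height (c (d - b)))
          + scale (of_nat b) (T i j (Suc r) (c (d - b)))"
        using height_T[OF act.hyps(2,3), of "c (d - b)" "Suc r"] c b by simp
      also have "\<dots> = scale (\<kappa> + of_nat (d - b) + of_nat b) (T i j (Suc r) (c (d - b)))"
        using c act.hyps by (simp add: T_scale scale_left_distrib[symmetric] add.assoc)
      also have "\<kappa> + of_nat (d - b) + of_nat b = \<kappa> + of_nat d"
        using True by (simp add: of_nat_diff)
      finally show ?thesis using True by (simp add: c'_def)
    qed (simp add: c'_def height_zero)
    have "T i j (Suc r) x = (\<Sum>d\<le>D. T i j (Suc r) (c d))"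
      using c act.hyps by (simp add: T_sum)
    also have "\<dots> = (\<Sum>d\<in>{b..D + b}. c' d)"
      by (rule sum.reindex_bij_witness[of _ "\<lambda>d. d - b" "\<lambda>d. d + b"]) (auto simp: c'_def)
    also have "\<dots> = (\<Sum>d\<le>D + b. c' d)"
      by (rule sum.mono_neutral_left) (auto simp: c'_def)
    finally have "?P (D + b) c' 0 (T i j (Suc r) x)"
      using eig c b act.hyps by (auto simp: c'_def T_closed zero_mem T_zero)
    then show ?case by blast
  next
    case (add d x y)
    then obtain D c a D' c' a' where c: "?P D c a x" "?P D' c' a' y" by metis
    have "(\<Sum>d\<le>D. c d) = (\<Sum>d\<le>D + D'. c d)"
      by (rule sum.mono_neutral_left) (use c in auto)
    moreover have "(\<Sum>d\<le>D'. c' d) = (\<Sum>d\<le>D + D'. c' d)"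
      by (rule sum.mono_neutral_left) (use c in auto)
    ultimately have "?P (D + D') (\<lambda>d. c d + c' d) (a + a') (x + y)"
      using c by (auto simp: add_mem height_add scale_right_distrib scale_left_distrib sum.distrib)
    then show ?case by (intro exI)
  next
    case (scale d x b)
    then obtain D c a where c: "?P D c a x" by blast
    then have "?P D (\<lambda>d. scale b (c d)) (b * a) (scale b x)"
      by (auto simp: scale_mem height_scale scale_sum_right mult.commute)
    then show ?case by (intro exI)
  qed
  then obtain D c a where c: "?P D c a x" by blast
  define c' where "c' = (\<lambda>d. if d = 0 then c 0 - x else c d)"
  have "x \<in> V" using reach_mem x v by blast
  have "(\<Sum>d\<le>D. c' d) = (\<Sum>d\<le>D. c d - (if d = 0 then x else 0))"
    by (intro sum.cong) (auto simp: c'_def)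
  also have "\<dots> = 0" using c by (simp add: sum_subtractf)
  finally have sum0: "(\<Sum>d\<le>D. c' d) = 0" .
  have c_eig: "c d \<in> V" "height (c d) = scale (\<kappa> + of_nat d) (c d)" for d
    using c by blast+
  have "c' d \<in> V \<and> height (c' d) = scale (\<kappa> + of_nat d) (c' d)" for d
    using c_eig h(2) \<open>x \<in> V\<close>
    by (cases "d = 0") (simp_all add: c'_def diff_mem height_diff scale_right_diff_distrib)
  then have "c' 0 = 0"
    by (rule height_eigenvectors_independent[OF _ sum0]) simp
  then have "x = c 0" by (simp add: c'_def)
  also have "c 0 = scale a v" using c by blast
  finally show ?thesis ..
qed

lemma hw_vector_height:
  assumes "hw_vector A v"
  shows "height v = scale (\<Sum>i\<in>{1..n}. of_nat i * fps_nth (A i) (Suc 0)) v"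
  using assms by (simp add: height_def hw_vector_def scale_sum_left)

end

text \<open>
  In the direct sum of the two modules let \<open>K\<close> be the submodule generated by \<open>(v1, v2)\<close>.  Its
  space of highest weight is spanned by \<open>(v1, v2)\<close>, so \<open>(v1, 0)\<close> is not in \<open>K\<close> and, by
  irreducibility, \<open>K\<close> meets the first summand in \<open>0\<close>.  So \<open>K\<close> is the graph of a homomorphism to
  the first module, which is onto, from a submodule of the second.
\<close>

lemma irreducible_subquotient_of_hw_module:
  fixes scale1 :: "complex \<Rightarrow> 'v::ab_group_add \<Rightarrow> 'v"
    and scale2 :: "complex \<Rightarrow> 'a::ab_group_add \<Rightarrow> 'a"
  assumes irr: "irreducible_fin_dim_module scale1 n V1 T1"
    and mod2: "yangian_module scale2 n V2 T2"
    and hw1: "yangian_module.hw_vector scale1 n V1 T1 A v1" and v1: "v1 \<noteq> 0"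
    and hw2: "yangian_module.hw_vector scale2 n V2 T2 A v2" and v2: "v2 \<noteq> 0"
  shows "isomorphic_to_subquotient n scale2 V2 T2 scale1 V1 T1"
proof -
  interpret M1: yangian_module scale1 n V1 T1
    using irr by (simp add: irreducible_fin_dim_module_def)
  interpret M2: yangian_module scale2 n V2 T2 by (rule mod2)
  have simple: "W = {0} \<or> W = V1" if "yangian_submodule scale1 n V1 T1 W" for W
    using irr that by (simp add: irreducible_fin_dim_module_def)
  define S :: "complex \<Rightarrow> 'v \<times> 'a \<Rightarrow> 'v \<times> 'a"
    where "S = (\<lambda>c x. (scale1 c (fst x), scale2 c (snd x)))"
  define T where "T = (\<lambda>i j r (x :: 'v \<times> 'a). (T1 i j r (fst x), T2 i j r (snd x)))"
  have S_eq: "S c (a, b) = (scale1 c a, scale2 c b)" for c a b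
    by (simp add: S_def)
  have T_eq: "T i j r (a, b) = (T1 i j r a, T2 i j r b)" for i j r a b
    by (simp add: T_def)
  interpret vector_space S
    by unfold_locales
      (auto simp: S_def M1.scale_right_distrib M1.scale_left_distrib
        M2.scale_right_distrib M2.scale_left_distrib)
  interpret M: yangian_module S n "V1 \<times> V2" T
  proof unfold_locales
    show "subspace (V1 \<times> V2)"
      unfolding subspace_def using M1.zero_mem M2.zero_mem
      by (auto simp: zero_prod_def S_def
          intro: M1.add_mem M2.add_mem M1.scale_mem M2.scale_mem)
  qed (auto simp: T_def S_def M1.T_add M2.T_add M1.T_scale M2.T_scale M1.T_closed M2.T_closed
      M1.T_zeroth M2.T_zeroth M1.T_relation M2.T_relation zero_prod_def)
  have hw: "M.hw_vector A (v1, v2)"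
    using hw1 hw2
    unfolding M.hw_vector_def M1.hw_vector_def M2.hw_vector_def
    by (auto simp: T_eq S_eq zero_prod_def)
  have v_mem: "v1 \<in> V1" "v2 \<in> V2" "(v1, v2) \<in> V1 \<times> V2"
    using hw1 hw2 by (auto simp: M1.hw_vector_def M2.hw_vector_def)
  define K where "K = {x. \<exists>d. M.cyclic (v1, v2) d x}"
  have K_mem: "a \<in> V1 \<and> b \<in> V2" if "(a, b) \<in> K" for a b
    using that M.reach_mem[OF _ v_mem(3)] by (force simp: K_def)
  have K_v: "(v1, v2) \<in> K"
    by (auto simp: K_def intro: M.reach.start)
  have K_zero: "(0, 0) \<in> K"
    using M.reach_zero by (auto simp: K_def zero_prod_def)
  have K_add: "(a + a', b + b') \<in> K" if "(a, b) \<in> K" "(a', b') \<in> K" for a b a' b'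
  proof -
    from that obtain d d' where "M.cyclic (v1, v2) d (a, b)" "M.cyclic (v1, v2) d' (a', b')"
      by (auto simp: K_def)
    then have "M.cyclic (v1, v2) (d + d') ((a, b) + (a', b'))"
      by (intro M.reach.add) (auto elim: M.reach_mono)
    then show ?thesis by (auto simp: K_def)
  qed
  have K_scale: "(scale1 c a, scale2 c b) \<in> K" if "(a, b) \<in> K" for a b c
  proof -
    from that obtain d where "M.cyclic (v1, v2) d (a, b)" by (auto simp: K_def)
    from M.reach.scale[OF this, of c] show ?thesis by (auto simp: K_def S_eq)
  qed
  have K_diff: "(a - a', b - b') \<in> K" if "(a, b) \<in> K" "(a', b') \<in> K" for a b a' b'
    using K_add[OF that(1) K_scale[OF that(2), of "-1"]] by simp
  have K_T: "(T1 i j r a, T2 i j r b) \<in> K"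
    if "(a, b) \<in> K" "i \<in> {1..n}" "j \<in> {1..n}" for a b i j r
    using that M.cyclic_T[OF _ v_mem(3), of _ "(a, b)" i j r] by (auto simp: K_def T_eq)

  have "yangian_submodule scale1 n V1 T1 {a. (a, 0) \<in> K}"
    unfolding yangian_submodule_def M1.subspace_def
    using K_mem K_zero K_add[of _ 0 _ 0] K_scale[of _ 0] K_T[of _ 0]
    by (auto simp: M2.T_zero simp del: atLeastAtMost_iff)
  moreover have "(v1, 0) \<notin> K"
  proof
    assume "(v1, 0) \<in> K"
    then obtain d where d: "M.cyclic (v1, v2) d (v1, 0)" by (auto simp: K_def)
    define \<mu> where "\<mu> = (\<Sum>i\<in>{1..n}. of_nat i * fps_nth (A i) (Suc 0))"
    have "M.hw_vector A (v1, 0)"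
      using hw1 M2.zero_mem
      unfolding M.hw_vector_def M1.hw_vector_def
      by (auto simp: T_eq S_eq zero_prod_def M2.T_zero)
    from M.hw_space_one_dimensional[OF hw d M.hw_vector_height[OF hw] M.hw_vector_height[OF this]]
    obtain c where "(v1, 0) = S c (v1, v2)" by blast
    then show False using v1 v2 by (auto simp: S_eq)
  qed
  ultimately have kernel: "a = 0" if "(a, 0) \<in> K" for a
    using simple v_mem that by blast
  have "yangian_submodule scale1 n V1 T1 {a. \<exists>b. (a, b) \<in> K}"
    unfolding yangian_submodule_def M1.subspace_def
    using K_mem K_zero by (blast intro: K_add K_scale K_T)
  then have onto: "\<exists>b. (a, b) \<in> K" if "a \<in> V1" for a
    using simple K_v v1 that by blast

  define M where "M = {b. \<exists>a. (a, b) \<in> K}"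
  define N where "N = {b. (0, b) \<in> K}"
  have subM: "yangian_submodule scale2 n V2 T2 M"
    unfolding M_def yangian_submodule_def M2.subspace_def
    using K_mem K_zero by (blast intro: K_add K_scale K_T)
  have subN: "yangian_submodule scale2 n V2 T2 N"
    unfolding N_def yangian_submodule_def M2.subspace_def
    using K_mem K_zero K_add[of 0 _ 0] K_scale[of 0] K_T[of 0]
    by (auto simp: M1.T_zero simp del: atLeastAtMost_iff)
  define \<phi> where "\<phi> = (\<lambda>C. THE a. \<exists>b\<in>C. (a, b) \<in> K)"
  have \<phi>: "\<phi> (b +o N) = a" if ab: "(a, b) \<in> K" for a b
    unfolding \<phi>_def
  proof (rule the_equality)
    show "\<exists>b'\<in>b +o N. (a, b') \<in> K"
      using ab K_zero by (auto simp: elt_set_plus_def N_def intro!: bexI[of _ 0])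
  next
    fix a' assume "\<exists>b'\<in>b +o N. (a', b') \<in> K"
    then obtain c where c: "(0, c) \<in> K" "(a', b + c) \<in> K"
      by (auto simp: elt_set_plus_def N_def)
    then have "(a' - a, 0) \<in> K"
      using K_diff[OF K_diff[OF c(2) ab] c(1)] by simp
    then show "a' = a" using kernel by fastforce
  qed
  have coset: "b +o N = b' +o N" if "(0, b - b') \<in> K" for b b'
  proof -
    have sub: "b +o N \<subseteq> b' +o N" if "(0, b - b') \<in> K" for b b'
    proof
      fix x assume "x \<in> b +o N"
      then obtain c where "x = b + c" "(0, c) \<in> K" by (auto simp: elt_set_plus_def N_def)
      then show "x \<in> b' +o N"
        using K_add[OF that, of 0 c]
        by (auto simp: elt_set_plus_def N_def intro!: bexI[of _ "b - b' + c"])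
    qed
    show ?thesis using sub[OF that] sub[of b' b] K_diff[OF K_zero that] by simp
  qed
  have "isomorphic_to_quotient n scale2 M N T2 scale1 V1 T1"
    unfolding isomorphic_to_quotient_def
  proof (intro exI[of _ \<phi>] conjI ballI allI)
    show "bij_betw \<phi> ((\<lambda>x. x +o N) ` M) V1"
      unfolding bij_betw_def
    proof
      show "inj_on \<phi> ((\<lambda>x. x +o N) ` M)"
      proof (rule inj_onI, clarsimp simp: M_def)
        fix b b' a a' assume *: "(a, b) \<in> K" "(a', b') \<in> K" "\<phi> (b +o N) = \<phi> (b' +o N)"
        then have "a = a'" using \<phi> by simp
        then show "b +o N = b' +o N" using coset K_diff[OF *(1,2)] by simp
      qed
      show "\<phi> ` (\<lambda>x. x +o N) ` M = V1"
        using \<phi> onto K_mem by (force simp: M_def image_iff)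
    qed
  next
    fix x y assume "x \<in> M" "y \<in> M"
    then show "\<phi> ((x + y) +o N) = \<phi> (x +o N) + \<phi> (y +o N)"
      using \<phi> K_add by (fastforce simp: M_def)
  next
    fix c x assume "x \<in> M"
    then show "\<phi> (scale2 c x +o N) = scale1 c (\<phi> (x +o N))"
      using \<phi> K_scale by (fastforce simp: M_def)
  next
    fix i j r x assume "i \<in> {1..n}" "j \<in> {1..n}" "x \<in> M"
    then show "\<phi> (T2 i j r x +o N) = T1 i j r (\<phi> (x +o N))"
      using \<phi> K_T by (fastforce simp: M_def)
  qed
  moreover have "N \<subseteq> M" by (auto simp: M_def N_def)
  ultimately show ?thesis
    using subM subN unfolding isomorphic_to_subquotient_def by blast
qed

section \<open>Tensor products are modules over the Yangian\<close>

lemma words_0: "words n 0 = {[]}"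
  by (auto simp: words_def)

lemma words_Suc: "words n (Suc m) = (\<lambda>(c, w). c # w) ` ({1..n} \<times> words n m)"
  by (auto simp: words_def length_Suc_conv image_iff)

lemma finite_words [simp]: "finite (words n m)"
  by (induction m) (simp_all add: words_0 words_Suc)

lemma sum_words_Suc:
  "(\<Sum>w\<in>words n (Suc m). g w) = (\<Sum>c\<in>{1..n}. \<Sum>w\<in>words n m. g (c # w))"
  unfolding words_Suc
  by (subst sum.reindex) (auto simp: inj_on_def sum.cartesian_product case_prod_unfold)

text \<open>
  The matrices \<open>T_ij(u)\<close> and \<open>T_ij(v)\<close> are \<open>a i j\<close> and \<open>b i j\<close>, with entries indexed by \<open>W\<close>.
  With \<open>p = u - v\<close> and \<open>q = 1\<close>, up to a common factor, this is the defining relation with the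
  products in which \<open>u\<close> comes before \<open>v\<close> collected on the left.
\<close>

definition matrix_prod :: "'w set \<Rightarrow> ('w \<Rightarrow> 'w \<Rightarrow> 'r::comm_ring_1) \<Rightarrow> ('w \<Rightarrow> 'w \<Rightarrow> 'r) \<Rightarrow> 'w \<Rightarrow> 'w \<Rightarrow> 'r"
  where "matrix_prod W a b w' w = (\<Sum>m\<in>W. a w' m * b m w)"

definition exchange_relation ::
  "nat \<Rightarrow> 'r::comm_ring_1 \<Rightarrow> 'r \<Rightarrow> 'w set \<Rightarrow> (nat \<Rightarrow> nat \<Rightarrow> 'w \<Rightarrow> 'w \<Rightarrow> 'r) \<Rightarrow>
     (nat \<Rightarrow> nat \<Rightarrow> 'w \<Rightarrow> 'w \<Rightarrow> 'r) \<Rightarrow> bool" where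
  "exchange_relation n p q W a b \<longleftrightarrow>
     (\<forall>i\<in>{1..n}. \<forall>j\<in>{1..n}. \<forall>k\<in>{1..n}. \<forall>l\<in>{1..n}. \<forall>w'\<in>W. \<forall>w\<in>W.
        p * matrix_prod W (a i j) (b k l) w' w - q * matrix_prod W (a k j) (b i l) w' w
        = p * matrix_prod W (b k l) (a i j) w' w - q * matrix_prod W (b k j) (a i l) w' w)"

lemma matrix_prod_coproduct:
  assumes "finite C"
  shows "(\<Sum>m1\<in>W1. \<Sum>m2\<in>W2. (\<Sum>c\<in>C. a1 c x1 m1 * a2 c x2 m2) * (\<Sum>d\<in>C. b1 d m1 y1 * b2 d m2 y2))
    = (\<Sum>c\<in>C. \<Sum>d\<in>C. matrix_prod W1 (a1 c) (b1 d) x1 y1 * matrix_prod W2 (a2 c) (b2 d) x2 y2)"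
proof -
  have "(\<Sum>m1\<in>W1. \<Sum>m2\<in>W2. (\<Sum>c\<in>C. a1 c x1 m1 * a2 c x2 m2) * (\<Sum>d\<in>C. b1 d m1 y1 * b2 d m2 y2))
      = (\<Sum>m1\<in>W1. \<Sum>m2\<in>W2. \<Sum>c\<in>C. \<Sum>d\<in>C. (a1 c x1 m1 * b1 d m1 y1) * (a2 c x2 m2 * b2 d m2 y2))"
    by (intro sum.cong refl) (simp add: sum_product ac_simps)
  also have "\<dots> = (\<Sum>m1\<in>W1. \<Sum>c\<in>C. \<Sum>d\<in>C. \<Sum>m2\<in>W2. (a1 c x1 m1 * b1 d m1 y1) * (a2 c x2 m2 * b2 d m2 y2))"
    by (simp only: sum.swap[of _ _ W2])
  also have "\<dots> = (\<Sum>c\<in>C. \<Sum>d\<in>C. \<Sum>m1\<in>W1. \<Sum>m2\<in>W2. (a1 c x1 m1 * b1 d m1 y1) * (a2 c x2 m2 * b2 d m2 y2))"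
    by (simp only: sum.swap[of _ _ W1])
  also have "\<dots> = (\<Sum>c\<in>C. \<Sum>d\<in>C. matrix_prod W1 (a1 c) (b1 d) x1 y1 * matrix_prod W2 (a2 c) (b2 d) x2 y2)"
    by (intro sum.cong refl) (simp add: matrix_prod_def sum_product)
  finally show ?thesis .
qed

text \<open>
  The relation passes to tensor products because the matrices of the two factors commute: apply it
  in the first factor, exchange the names of the two summation indices in the term with \<open>q\<close>, and
  apply it in the second.
\<close>

lemma exchange_relation_coproduct:
  assumes 1: "exchange_relation n p q W1 a1 b1" and 2: "exchange_relation n p q W2 a2 b2"
    and ijkl: "i \<in> {1..n}" "j \<in> {1..n}" "k \<in> {1..n}" "l \<in> {1..n}"
    and xy: "x1 \<in> W1" "y1 \<in> W1" "x2 \<in> W2" "y2 \<in> W2"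
  defines "a \<equiv> \<lambda>i j x1 x2 y1 y2. \<Sum>c\<in>{1..n}. a1 i c x1 y1 * a2 c j x2 y2"
    and "b \<equiv> \<lambda>i j x1 x2 y1 y2. \<Sum>c\<in>{1..n}. b1 i c x1 y1 * b2 c j x2 y2"
  shows "p * (\<Sum>m1\<in>W1. \<Sum>m2\<in>W2. a i j x1 x2 m1 m2 * b k l m1 m2 y1 y2)
        - q * (\<Sum>m1\<in>W1. \<Sum>m2\<in>W2. a k j x1 x2 m1 m2 * b i l m1 m2 y1 y2)
      = p * (\<Sum>m1\<in>W1. \<Sum>m2\<in>W2. b k l x1 x2 m1 m2 * a i j m1 m2 y1 y2)
        - q * (\<Sum>m1\<in>W1. \<Sum>m2\<in>W2. b k j x1 x2 m1 m2 * a i l m1 m2 y1 y2)"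
proof -
  define X1 where "X1 = (\<lambda>i j k l. matrix_prod W1 (a1 i j) (b1 k l) x1 y1)"
  define Y1 where "Y1 = (\<lambda>k l i j. matrix_prod W1 (b1 k l) (a1 i j) x1 y1)"
  define X2 where "X2 = (\<lambda>i j k l. matrix_prod W2 (a2 i j) (b2 k l) x2 y2)"
  define Y2 where "Y2 = (\<lambda>k l i j. matrix_prod W2 (b2 k l) (a2 i j) x2 y2)"
  let ?N = "{1..n}"
  have ab: "(\<Sum>m1\<in>W1. \<Sum>m2\<in>W2. a i j x1 x2 m1 m2 * b k l m1 m2 y1 y2)
      = (\<Sum>c\<in>?N. \<Sum>d\<in>?N. X1 i c k d * X2 c j d l)" for i j k l
    unfolding a_def b_def X1_def X2_def by (rule matrix_prod_coproduct) simp
  have ba: "(\<Sum>m1\<in>W1. \<Sum>m2\<in>W2. b k l x1 x2 m1 m2 * a i j m1 m2 y1 y2)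
      = (\<Sum>d\<in>?N. \<Sum>c\<in>?N. Y1 k d i c * Y2 d l c j)" for i j k l
    unfolding a_def b_def Y1_def Y2_def by (rule matrix_prod_coproduct) simp
  have R1: "p * X1 i c k d - q * X1 k c i d = p * Y1 k d i c - q * Y1 k c i d"
    if "c \<in> ?N" "d \<in> ?N" for c d
    using 1 ijkl that xy unfolding exchange_relation_def X1_def Y1_def by blast
  have R2: "p * X2 c j d l - q * X2 d j c l = p * Y2 d l c j - q * Y2 d j c l"
    if "c \<in> ?N" "d \<in> ?N" for c d
    using 2 ijkl that xy unfolding exchange_relation_def X2_def Y2_def by blast
  have "p * (\<Sum>c\<in>?N. \<Sum>d\<in>?N. X1 i c k d * X2 c j d l) - q * (\<Sum>c\<in>?N. \<Sum>d\<in>?N. X1 k c i d * X2 c j d l)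
      = (\<Sum>c\<in>?N. \<Sum>d\<in>?N. (p * X1 i c k d - q * X1 k c i d) * X2 c j d l)"
    by (simp add: sum_distrib_left sum_subtractf algebra_simps)
  also have "\<dots> = (\<Sum>c\<in>?N. \<Sum>d\<in>?N. (p * Y1 k d i c - q * Y1 k c i d) * X2 c j d l)"
    using R1 by (intro sum.cong refl) simp
  also have "\<dots> = p * (\<Sum>c\<in>?N. \<Sum>d\<in>?N. Y1 k d i c * X2 c j d l)
      - q * (\<Sum>c\<in>?N. \<Sum>d\<in>?N. Y1 k c i d * X2 c j d l)"
    by (simp add: sum_distrib_left sum_subtractf algebra_simps)
  also have "(\<Sum>c\<in>?N. \<Sum>d\<in>?N. Y1 k d i c * X2 c j d l) = (\<Sum>d\<in>?N. \<Sum>c\<in>?N. Y1 k d i c * X2 c j d l)"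
    by (rule sum.swap)
  also have "p * (\<Sum>d\<in>?N. \<Sum>c\<in>?N. Y1 k d i c * X2 c j d l)
      - q * (\<Sum>c\<in>?N. \<Sum>d\<in>?N. Y1 k c i d * X2 c j d l)
      = (\<Sum>d\<in>?N. \<Sum>c\<in>?N. Y1 k d i c * (p * X2 c j d l - q * X2 d j c l))"
    by (simp add: sum_distrib_left sum_subtractf algebra_simps)
  also have "\<dots> = (\<Sum>d\<in>?N. \<Sum>c\<in>?N. Y1 k d i c * (p * Y2 d l c j - q * Y2 d j c l))"
    using R2 by (intro sum.cong refl) simp
  also have "\<dots> = p * (\<Sum>d\<in>?N. \<Sum>c\<in>?N. Y1 k d i c * Y2 d l c j)
      - q * (\<Sum>d\<in>?N. \<Sum>c\<in>?N. Y1 k d i c * Y2 d j c l)"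
    by (simp add: sum_distrib_left sum_subtractf algebra_simps)
  finally show ?thesis unfolding ab ba .
qed

definition delta :: "nat \<Rightarrow> nat \<Rightarrow> 'r::comm_ring_1" where
  "delta i j = (if i = j then 1 else 0)"

text \<open>
  For vector and for covector modules the terms that do not cancel are those with \<open>\<rho> * \<rho>'\<close>, multiplied
  by \<open>p\<close>, and those with \<open>\<rho>' - \<rho>\<close>, multiplied by \<open>q\<close>.  Their cofactors agree.
\<close>

lemma exchange_relation_vector:
  fixes \<rho> \<rho>' :: "'r::comm_ring_1"
  assumes "p * (\<rho> * \<rho>') = q * (\<rho>' - \<rho>)"
  shows "exchange_relation n p q {1..n}
    (\<lambda>i j b a. delta i j * delta b a + delta j a * delta b i * \<rho>)
    (\<lambda>i j b a. delta i j * delta b a + delta j a * delta b i * \<rho>')"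
proof -
  have prod: "matrix_prod {1..n}
      (\<lambda>b a. delta i j * delta b a + delta j a * delta b i * x)
      (\<lambda>b a. delta k l * delta b a + delta l a * delta b k * y) b a
      = delta i j * delta k l * delta b a + delta i j * delta l a * delta b k * y
        + delta k l * delta j a * delta b i * x + delta j k * delta b i * delta l a * (x * y)"
    if "i \<in> {1..n}" "j \<in> {1..n}" "k \<in> {1..n}" "l \<in> {1..n}" "b \<in> {1..n}" "a \<in> {1..n}"
    for x y :: 'r and i j k l b a
    using that unfolding matrix_prod_def delta_def
    by (simp add: if_distrib[where f = "\<lambda>x. x * _"] if_distrib[where f = "\<lambda>x. _ * x"] distrib_left distrib_right
        sum.distrib cong: if_cong)
  show ?thesis
    unfolding exchange_relation_def
  proof (intro ballI)
    fix i j k l b a assume *: "i \<in> {1..n}" "j \<in> {1..n}" "k \<in> {1..n}" "l \<in> {1..n}" "b \<in> {1..n}" "a \<in> {1..n}"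
    have "(p * (\<rho> * \<rho>') - q * (\<rho>' - \<rho>))
        * (delta j k * delta b i * delta l a - delta l i * delta b k * delta j a) = 0"
      using assms by simp
    then show "p * matrix_prod {1..n} (\<lambda>b a. delta i j * delta b a + delta j a * delta b i * \<rho>)
          (\<lambda>b a. delta k l * delta b a + delta l a * delta b k * \<rho>') b a
        - q * matrix_prod {1..n} (\<lambda>b a. delta k j * delta b a + delta j a * delta b k * \<rho>)
          (\<lambda>b a. delta i l * delta b a + delta l a * delta b i * \<rho>') b a
        = p * matrix_prod {1..n} (\<lambda>b a. delta k l * delta b a + delta l a * delta b k * \<rho>')
          (\<lambda>b a. delta i j * delta b a + delta j a * delta b i * \<rho>) b a
        - q * matrix_prod {1..n} (\<lambda>b a. delta k j * delta b a + delta j a * delta b k * \<rho>')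
          (\<lambda>b a. delta i l * delta b a + delta l a * delta b i * \<rho>) b a"
      unfolding prod[OF *] prod[OF *(3,4,1,2,5,6)] prod[OF *(1,4,3,2,5,6)] prod[OF *(3,2,1,4,5,6)]
      by (auto simp: algebra_simps delta_def)
  qed
qed

lemma exchange_relation_covector:
  fixes \<rho> \<rho>' :: "'r::comm_ring_1"
  assumes "p * (\<rho> * \<rho>') = q * (\<rho>' - \<rho>)"
  shows "exchange_relation n p q {1..n}
    (\<lambda>i j b a. delta i j * delta b a - delta i a * delta b j * \<rho>)
    (\<lambda>i j b a. delta i j * delta b a - delta i a * delta b j * \<rho>')"
proof -
  have prod: "matrix_prod {1..n}
      (\<lambda>b a. delta i j * delta b a - delta i a * delta b j * x)
      (\<lambda>b a. delta k l * delta b a - delta k a * delta b l * y) b a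
      = delta i j * delta k l * delta b a - delta i j * delta k a * delta b l * y
        - delta k l * delta i a * delta b j * x + delta i l * delta b j * delta k a * (x * y)"
    if "i \<in> {1..n}" "j \<in> {1..n}" "k \<in> {1..n}" "l \<in> {1..n}" "b \<in> {1..n}" "a \<in> {1..n}"
    for x y :: 'r and i j k l b a
    using that unfolding matrix_prod_def delta_def
    by (simp add: if_distrib[where f = "\<lambda>x. x * _"] if_distrib[where f = "\<lambda>x. _ * x"]
        left_diff_distrib right_diff_distrib sum_subtractf cong: if_cong)
  show ?thesis
    unfolding exchange_relation_def
  proof (intro ballI)
    fix i j k l b a assume *: "i \<in> {1..n}" "j \<in> {1..n}" "k \<in> {1..n}" "l \<in> {1..n}" "b \<in> {1..n}" "a \<in> {1..n}"
    have "(p * (\<rho> * \<rho>') - q * (\<rho>' - \<rho>))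
        * (delta i l * delta b j * delta k a - delta k j * delta b l * delta i a) = 0"
      using assms by simp
    then show "p * matrix_prod {1..n} (\<lambda>b a. delta i j * delta b a - delta i a * delta b j * \<rho>)
          (\<lambda>b a. delta k l * delta b a - delta k a * delta b l * \<rho>') b a
        - q * matrix_prod {1..n} (\<lambda>b a. delta k j * delta b a - delta k a * delta b j * \<rho>)
          (\<lambda>b a. delta i l * delta b a - delta i a * delta b l * \<rho>') b a
        = p * matrix_prod {1..n} (\<lambda>b a. delta k l * delta b a - delta k a * delta b l * \<rho>')
          (\<lambda>b a. delta i j * delta b a - delta i a * delta b j * \<rho>) b a
        - q * matrix_prod {1..n} (\<lambda>b a. delta k j * delta b a - delta k a * delta b j * \<rho>')
          (\<lambda>b a. delta i l * delta b a - delta i a * delta b l * \<rho>) b a"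
      unfolding prod[OF *] prod[OF *(3,4,1,2,5,6)] prod[OF *(1,4,3,2,5,6)] prod[OF *(3,2,1,4,5,6)]
      by (auto simp: algebra_simps delta_def)
  qed
qed

text \<open>
  Series in \<open>u^(-1)\<close> and \<open>v^(-1)\<close> are series in \<open>v^(-1)\<close> whose coefficients are series in
  \<open>u^(-1)\<close>.  So \<^const>\<open>fps_const\<close> embeds the series in \<open>u^(-1)\<close>, and the following function
  those in \<open>v^(-1)\<close>.
\<close>

definition outer_series :: "complex fps \<Rightarrow> complex fps fps" where
  "outer_series f = Abs_fps (\<lambda>s. fps_const (fps_nth f s))"

lemma outer_series_nth [simp]: "fps_nth (outer_series f) s = fps_const (fps_nth f s)"
  by (simp add: outer_series_def)

lemma outer_series_simps [simp]:
  "outer_series 0 = 0" "outer_series 1 = 1" "outer_series fps_X = fps_X"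
  "outer_series (f + g) = outer_series f + outer_series g"
  "outer_series (f - g) = outer_series f - outer_series g"
  by (simp_all add: fps_eq_iff)

lemma fps_const_sum: "fps_const (sum f A) = (\<Sum>a\<in>A. fps_const (f a))"
  by (induction A rule: infinite_finite_induct) (simp_all flip: fps_const_add)

lemma outer_series_sum: "outer_series (sum f A) = (\<Sum>a\<in>A. outer_series (f a))"
  by (induction A rule: infinite_finite_induct) simp_all

lemma outer_series_mult [simp]: "outer_series (f * g) = outer_series f * outer_series g"
  by (simp add: fps_eq_iff fps_mult_nth fps_sum_nth)

lemma recip_series_eq: "recip_series c * (1 - fps_const c * fps_X) = fps_X"
proof -
  have "fps_nth (1 - fps_const c * fps_X) 0 \<noteq> 0" by simp
  then have "inverse (1 - fps_const c * fps_X) * (1 - fps_const c * fps_X) = 1"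
    by (rule inverse_mult_eq_1)
  then show ?thesis by (simp only: recip_series_def mult.assoc mult_1_right)
qed

lemma recip_series_zeroth: "fps_nth (recip_series c) 0 = 0"
  by (simp add: recip_series_def)

text \<open>\<open>(u - v) / ((u - c) (v - c)) = 1 / (v - c) - 1 / (u - c)\<close>, multiplied by
  \<open>u^(-1) v^(-1)\<close>.\<close>

lemma recip_series_exchange:
  fixes c :: complex
  defines "\<rho> \<equiv> fps_const (recip_series c)" and "\<rho>' \<equiv> outer_series (recip_series c)"
    and "x \<equiv> fps_const (fps_X :: complex fps)"
  shows "(fps_X - x) * (\<rho> * \<rho>') = (x * fps_X) * (\<rho>' - \<rho>)"
proof -
  define k where "k = fps_const (fps_const c)"
  have 1: "\<rho> * (1 - k * x) = x"
    using arg_cong[OF recip_series_eq[of c], of fps_const] by (simp add: \<rho>_def k_def x_def mult.commute)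
  have 2: "\<rho>' * (1 - k * fps_X) = fps_X"
  proof -
    have "outer_series (fps_const c) = k" by (simp add: fps_eq_iff k_def)
    then show ?thesis
      using arg_cong[OF recip_series_eq[of c], of outer_series] by (simp add: \<rho>'_def)
  qed
  have "(x * fps_X) * (\<rho>' - \<rho>) = x * (\<rho>' * fps_X) - fps_X * (\<rho> * x)"
    by (simp add: algebra_simps)
  also have "\<dots> = (\<rho> * (1 - k * x)) * (\<rho>' * fps_X) - (\<rho>' * (1 - k * fps_X)) * (\<rho> * x)"
    by (simp only: 1 2)
  also have "\<dots> = (fps_X - x) * (\<rho> * \<rho>')"
    by (simp add: algebra_simps)
  finally show ?thesis ..
qed

lemma exchange_relation_factor:
  "exchange_relation n (fps_X - fps_const fps_X) (fps_const fps_X * fps_X) {1..n}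
     (\<lambda>i j b a. fps_const (factor_series F i j b a)) (\<lambda>i j b a. outer_series (factor_series F i j b a))"
proof (cases F)
  case (Vector z)
  have "(\<lambda>i j b a. fps_const (factor_series F i j b a))
      = (\<lambda>i j b a. delta i j * delta b a + delta j a * delta b i * fps_const (recip_series z))"
    "(\<lambda>i j b a. outer_series (factor_series F i j b a))
      = (\<lambda>i j b a. delta i j * delta b a + delta j a * delta b i * outer_series (recip_series z))"
    by (auto simp: Vector delta_def fun_eq_iff)
  then show ?thesis by (simp only: exchange_relation_vector[OF recip_series_exchange])
next
  case (Covector z)
  have "(\<lambda>i j b a. fps_const (factor_series F i j b a))
      = (\<lambda>i j b a. delta i j * delta b a - delta i a * delta b j * fps_const (recip_series (z - 1)))"
    "(\<lambda>i j b a. outer_series (factor_series F i j b a))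
      = (\<lambda>i j b a. delta i j * delta b a - delta i a * delta b j * outer_series (recip_series (z - 1)))"
    by (auto simp: Covector delta_def fun_eq_iff)
  then show ?thesis by (simp only: exchange_relation_covector[OF recip_series_exchange])
qed

lemma exchange_relation_tensor:
  "exchange_relation n (fps_X - fps_const fps_X) (fps_const fps_X * fps_X) (words n (length Fs))
     (\<lambda>i j w' w. fps_const (tensor_series n Fs i j w' w))
     (\<lambda>i j w' w. outer_series (tensor_series n Fs i j w' w))"
proof (induction Fs)
  case Nil
  show ?case by (auto simp: exchange_relation_def words_0 matrix_prod_def)
next
  case (Cons F Fs)
  show ?case
    unfolding exchange_relation_def
  proof (intro ballI)
    fix i j k l x y
    assume ijkl: "i \<in> {1..n}" "j \<in> {1..n}" "k \<in> {1..n}" "l \<in> {1..n}"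
      and "x \<in> words n (length (F # Fs))" "y \<in> words n (length (F # Fs))"
    then obtain x1 x2 y1 y2 where [simp]: "x = x1 # x2" "y = y1 # y2"
      and xy: "x1 \<in> {1..n}" "y1 \<in> {1..n}" "x2 \<in> words n (length Fs)" "y2 \<in> words n (length Fs)"
      by (auto simp: words_Suc)
    show "(fps_X - fps_const fps_X)
          * matrix_prod (words n (length (F # Fs))) (\<lambda>w' w. fps_const (tensor_series n (F # Fs) i j w' w))
              (\<lambda>w' w. outer_series (tensor_series n (F # Fs) k l w' w)) x y
        - fps_const fps_X * fps_X
          * matrix_prod (words n (length (F # Fs))) (\<lambda>w' w. fps_const (tensor_series n (F # Fs) k j w' w))
              (\<lambda>w' w. outer_series (tensor_series n (F # Fs) i l w' w)) x y
        = (fps_X - fps_const fps_X)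
          * matrix_prod (words n (length (F # Fs))) (\<lambda>w' w. outer_series (tensor_series n (F # Fs) k l w' w))
              (\<lambda>w' w. fps_const (tensor_series n (F # Fs) i j w' w)) x y
        - fps_const fps_X * fps_X
          * matrix_prod (words n (length (F # Fs))) (\<lambda>w' w. outer_series (tensor_series n (F # Fs) k j w' w))
              (\<lambda>w' w. fps_const (tensor_series n (F # Fs) i l w' w)) x y"
      using exchange_relation_coproduct[OF exchange_relation_factor[of n F] Cons.IH ijkl xy]
      by (simp only: matrix_prod_def length_Cons sum_words_Suc tensor_series.simps list.sel
          \<open>x = x1 # x2\<close> \<open>y = y1 # y2\<close> fps_const_sum outer_series_sum fps_const_mult[symmetric] outer_series_mult)
  qed
qed

definition coeff_prod ::
  "nat \<Rightarrow> factor list \<Rightarrow> nat \<Rightarrow> nat \<Rightarrow> nat \<Rightarrow> nat \<Rightarrow> nat \<Rightarrow> nat \<Rightarrow> nat list \<Rightarrow> nat list \<Rightarrow> complex" where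
  "coeff_prod n Fs i j r k l s w' w = (\<Sum>m\<in>words n (length Fs).
     fps_nth (tensor_series n Fs i j w' m) r * fps_nth (tensor_series n Fs k l m w) s)"

lemma tensor_action_twice:
  assumes "w' \<in> words n (length Fs)"
  shows "tensor_action n Fs i j r (tensor_action n Fs k l s f) w'
    = (\<Sum>w\<in>words n (length Fs). coeff_prod n Fs i j r k l s w' w * f w)"
proof -
  have "tensor_action n Fs i j r (tensor_action n Fs k l s f) w'
      = (\<Sum>m\<in>words n (length Fs). \<Sum>w\<in>words n (length Fs).
          fps_nth (tensor_series n Fs i j w' m) r * (fps_nth (tensor_series n Fs k l m w) s * f w))"
    using assms by (simp add: tensor_action_def sum_distrib_left)
  also have "\<dots> = (\<Sum>w\<in>words n (length Fs). \<Sum>m\<in>words n (length Fs).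
          fps_nth (tensor_series n Fs i j w' m) r * (fps_nth (tensor_series n Fs k l m w) s * f w))"
    by (rule sum.swap)
  also have "\<dots> = (\<Sum>w\<in>words n (length Fs). coeff_prod n Fs i j r k l s w' w * f w)"
    by (simp add: coeff_prod_def sum_distrib_right mult.assoc)
  finally show ?thesis .
qed

lemma coeff_prod_relation:
  assumes "i \<in> {1..n}" "j \<in> {1..n}" "k \<in> {1..n}" "l \<in> {1..n}"
    "w' \<in> words n (length Fs)" "w \<in> words n (length Fs)"
  shows "(coeff_prod n Fs i j (Suc r) k l s w' w - coeff_prod n Fs k l s i j (Suc r) w' w)
      - (coeff_prod n Fs i j r k l (Suc s) w' w - coeff_prod n Fs k l (Suc s) i j r w' w)
      = coeff_prod n Fs k j r i l s w' w - coeff_prod n Fs k j s i l r w' w"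
proof -
  let ?W = "words n (length Fs)"
  let ?a = "\<lambda>i j w' w. fps_const (tensor_series n Fs i j w' w)"
  let ?b = "\<lambda>i j w' w. outer_series (tensor_series n Fs i j w' w)"
  have ab: "fps_nth (fps_nth (matrix_prod ?W (?a i j) (?b k l) w' w) s) r = coeff_prod n Fs i j r k l s w' w"
    for i j k l r s
    by (simp add: matrix_prod_def coeff_prod_def fps_sum_nth)
  have ba: "fps_nth (fps_nth (matrix_prod ?W (?b k l) (?a i j) w' w) s) r = coeff_prod n Fs k l s i j r w' w"
    for i j k l r s
    by (simp add: matrix_prod_def coeff_prod_def fps_sum_nth)
  define Z where "Z = matrix_prod ?W (?a i j) (?b k l) w' w - matrix_prod ?W (?b k l) (?a i j) w' w"
  define Z' where "Z' = matrix_prod ?W (?a k j) (?b i l) w' w - matrix_prod ?W (?b k j) (?a i l) w' w"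
  have "fps_X * Z - fps_const fps_X * Z = fps_const fps_X * (fps_X * Z')"
    using exchange_relation_tensor[of n Fs] assms
    unfolding exchange_relation_def Z_def Z'_def by (simp add: algebra_simps)
  from arg_cong[OF this, of "\<lambda>f. fps_nth (fps_nth f (Suc s)) (Suc r)"]
  have "fps_nth (fps_nth Z s) (Suc r) - fps_nth (fps_nth Z (Suc s)) r = fps_nth (fps_nth Z' s) r"
    by simp
  then show ?thesis by (simp add: Z_def Z'_def ab ba)
qed

lemma tensor_series_zeroth:
  assumes "i \<in> {1..n}" "j \<in> {1..n}" "w' \<in> words n (length Fs)" "w \<in> words n (length Fs)"
  shows "fps_nth (tensor_series n Fs i j w' w) 0 = (if i = j \<and> w' = w then 1 else 0)"
  using assms
proof (induction Fs arbitrary: i w' w)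
  case Nil
  then show ?case by (auto simp: words_0)
next
  case (Cons F Fs)
  obtain a v b v' where w: "w = a # v" "w' = b # v'"
    and v: "v \<in> words n (length Fs)" "v' \<in> words n (length Fs)"
    using Cons.prems by (auto simp: words_Suc)
  have F: "fps_nth (factor_series F i k b a) 0 = (if i = k \<and> b = a then 1 else 0)" for k
    by (cases F)
      (simp_all only: factor_series.simps fps_add_nth fps_sub_nth if_distrib[of "\<lambda>f. fps_nth f 0"]
        recip_series_zeroth fps_one_nth fps_zero_nth if_cancel if_True simp_thms add_0_right diff_0_right)
  have "fps_nth (tensor_series n (F # Fs) i j w' w) 0
      = (\<Sum>k\<in>{1..n}. fps_nth (factor_series F i k b a) 0 * fps_nth (tensor_series n Fs k j v' v) 0)"
    by (simp only: tensor_series.simps fps_sum_nth fps_mult_nth_0 list.sel w)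
  also have "\<dots> = (\<Sum>k\<in>{1..n}. if i = k then (if b = a \<and> i = j \<and> v' = v then 1 else 0) else 0)"
  proof (intro sum.cong refl)
    fix k assume "k \<in> {1..n}"
    then show "fps_nth (factor_series F i k b a) 0 * fps_nth (tensor_series n Fs k j v' v) 0
        = (if i = k then (if b = a \<and> i = j \<and> v' = v then 1 else 0) else 0)"
      using F[of k] Cons.IH[OF _ Cons.prems(2) v(2,1), of k] by simp
  qed
  also have "\<dots> = (if b = a \<and> i = j \<and> v' = v then 1 else 0)"
    using Cons.prems(1) by (simp only: sum.delta' finite_atLeastAtMost if_True)
  finally show ?case by (simp only: w list.inject) meson
qed

lemma tensor_yangian_module:
  "yangian_module fun_scale n (tensor_space n Fs) (tensor_action n Fs)"
proof -
  interpret vector_space fun_scale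
    by unfold_locales (auto simp: fun_scale_def fun_eq_iff algebra_simps)
  show ?thesis
  proof unfold_locales
    show "subspace (tensor_space n Fs)"
      by (auto simp: subspace_def tensor_space_def fun_scale_def)
  next
    fix i j r f assume "f \<in> tensor_space n Fs"
    show "tensor_action n Fs i j r f \<in> tensor_space n Fs"
      by (simp add: tensor_action_def tensor_space_def)
  next
    fix i j r and f g :: "nat list \<Rightarrow> complex"
    show "tensor_action n Fs i j r (f + g) = tensor_action n Fs i j r f + tensor_action n Fs i j r g"
      by (auto simp: tensor_action_def fun_eq_iff algebra_simps sum.distrib)
  next
    fix i j r c and f :: "nat list \<Rightarrow> complex"
    show "tensor_action n Fs i j r (fun_scale c f) = fun_scale c (tensor_action n Fs i j r f)"
      by (auto simp: tensor_action_def fun_scale_def fun_eq_iff sum_distrib_left mult.left_commute)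
  next
    fix i j f assume ij: "i \<in> {1..n}" "j \<in> {1..n}" and f: "f \<in> tensor_space n Fs"
    show "tensor_action n Fs i j 0 f = (if i = j then f else 0)"
    proof
      fix w'
      have "tensor_action n Fs i j 0 f w'
          = (\<Sum>w\<in>words n (length Fs). if w' = w then (if i = j then f w else 0) else 0)"
        if "w' \<in> words n (length Fs)"
        unfolding tensor_action_def if_P[OF that]
        by (intro sum.cong refl) (simp add: tensor_series_zeroth[OF ij that])
      then show "tensor_action n Fs i j 0 f w' = (if i = j then f else 0) w'"
        using f by (cases "w' \<in> words n (length Fs)") (auto simp: tensor_space_def tensor_action_def)
    qed
  next
    fix i j k l f r s assume *: "i \<in> {1..n}" "j \<in> {1..n}" "k \<in> {1..n}" "l \<in> {1..n}"
    show "tensor_action n Fs i j (Suc r) (tensor_action n Fs k l s f)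
        - tensor_action n Fs k l s (tensor_action n Fs i j (Suc r) f)
        - (tensor_action n Fs i j r (tensor_action n Fs k l (Suc s) f)
           - tensor_action n Fs k l (Suc s) (tensor_action n Fs i j r f))
        = tensor_action n Fs k j r (tensor_action n Fs i l s f)
          - tensor_action n Fs k j s (tensor_action n Fs i l r f)" (is "?L = ?R")
    proof
      fix w'
      show "?L w' = ?R w'"
      proof (cases "w' \<in> words n (length Fs)")
        case True
        have "(\<Sum>w\<in>words n (length Fs).
              ((coeff_prod n Fs i j (Suc r) k l s w' w - coeff_prod n Fs k l s i j (Suc r) w' w)
               - (coeff_prod n Fs i j r k l (Suc s) w' w - coeff_prod n Fs k l (Suc s) i j r w' w)) * f w)
            = (\<Sum>w\<in>words n (length Fs).
              (coeff_prod n Fs k j r i l s w' w - coeff_prod n Fs k j s i l r w' w) * f w)"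
          using coeff_prod_relation[OF * True, of _ r s] by (intro sum.cong refl) simp
        then show ?thesis
          by (simp only: minus_apply tensor_action_twice[OF True] left_diff_distrib sum_subtractf)
      next
        case False
        then show ?thesis by (simp add: tensor_action_def)
      qed
    qed
  qed
qed

section \<open>Expansions at infinity\<close>

lemma recip_series_diff:
  "recip_series a - recip_series b = fps_const (a - b) * (recip_series a * recip_series b)"
proof -
  let ?p = "\<lambda>c. 1 - fps_const c * fps_X :: complex fps"
  have nz: "?p c \<noteq> 0" for c
    by (intro fps_nonzeroI[of _ 0]) simp
  have "(recip_series a - recip_series b) * (?p a * ?p b)
      = (recip_series a * ?p a) * ?p b - (recip_series b * ?p b) * ?p a"
    by (simp add: algebra_simps)
  also have "\<dots> = fps_const (a - b) * (recip_series a * ?p a) * (recip_series b * ?p b)"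
    unfolding recip_series_eq by (simp add: algebra_simps flip: fps_const_sub)
  also have "\<dots> = fps_const (a - b) * (recip_series a * recip_series b) * (?p a * ?p b)"
    by (simp add: mult_ac)
  finally show ?thesis using nz[of a] nz[of b] by simp
qed

lemma expand_poly_pCons: "expand_poly (pCons a p) = fls_const a + fls_X_inv * expand_poly p"
  by (simp add: expand_poly_def map_poly_pCons)

lemma expand_poly_0 [simp]: "expand_poly 0 = 0"
  by (simp add: expand_poly_def)

lemma expand_poly_add: "expand_poly (p + q) = expand_poly p + expand_poly q"
  by (induction p q rule: poly_induct2)
    (simp_all add: expand_poly_pCons algebra_simps flip: fls_plus_const)

lemma expand_poly_smult: "expand_poly (smult c p) = fls_const c * expand_poly p"
  by (induction p) (simp_all add: expand_poly_pCons algebra_simps fls_const_mult_const)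

lemma expand_poly_mult: "expand_poly (p * q) = expand_poly p * expand_poly q"
  by (induction p) (simp_all add: expand_poly_pCons expand_poly_add expand_poly_smult algebra_simps)

lemma expand_poly_nth: "fls_nth (expand_poly p) m = (if m \<le> 0 then coeff p (nat (- m)) else 0)"
proof (induction p arbitrary: m)
  case (pCons a p)
  have "nat (- m) = Suc (nat (- (m + 1)))" if "m < 0"
    using that by simp
  then show ?case
    by (cases "m = 0")
      (auto simp: expand_poly_pCons fls_X_inv_times_conv_shift pCons.IH coeff_pCons split: nat.split)
qed simp

lemma expand_poly_eq_0_iff [simp]: "expand_poly p = 0 \<longleftrightarrow> p = 0"
proof
  assume "expand_poly p = 0"
  then have "coeff p k = 0" for k
    using expand_poly_nth[of p "- int k"] by simp
  then show "p = 0" by (simp add: poly_eq_iff)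
qed simp

lemma shift_poly_eq_0_iff [simp]: "shift_poly p = 0 \<longleftrightarrow> p = 0"
  by (simp add: shift_poly_def pcompose_eq_0_iff)

lemma shift_poly_mult: "shift_poly (p * q) = shift_poly p * shift_poly q"
  by (simp add: shift_poly_def pcompose_mult)

lemma poly_shift_ratio_mult:
  "poly_shift_ratio (p * q) = poly_shift_ratio p * poly_shift_ratio q"
  by (simp add: poly_shift_ratio_def shift_poly_mult expand_poly_mult)

lemma poly_shift_ratio_const: "c \<noteq> 0 \<Longrightarrow> poly_shift_ratio [:c:] = 1"
  using expand_poly_eq_0_iff[of "[:c:]"] by (simp add: poly_shift_ratio_def shift_poly_def)

lemma poly_shift_ratio_nonzero: "p \<noteq> 0 \<Longrightarrow> poly_shift_ratio p \<noteq> 0"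
  by (simp add: poly_shift_ratio_def)

lemma poly_shift_ratio_linear: "poly_shift_ratio [:- z, 1:] = fps_to_fls (1 + recip_series z)"
proof -
  have X: "fls_X_inv * fls_X = (1 :: complex fls)"
    by (simp add: fls_X_inv_times_conv_shift)
  define e where "e = fls_X_inv - fls_const z"
  define \<rho> where "\<rho> = fps_to_fls (recip_series z)"
  have "\<rho> * (1 - fls_const z * fls_X) = fls_X"
    using arg_cong[OF recip_series_eq[of z], of fps_to_fls]
    by (simp add: \<rho>_def fls_times_fps_to_fls)
  then have "fls_X_inv * (\<rho> * (1 - fls_const z * fls_X)) = 1"
    by (simp add: X)
  then have "\<rho> * (fls_X_inv - fls_const z * (fls_X_inv * fls_X)) = 1"
    by (simp add: algebra_simps)
  then have \<rho>: "\<rho> * e = 1" by (simp add: X e_def)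
  then have "e \<noteq> 0" by auto
  have "expand_poly [:- z, 1:] = e"
    by (simp add: expand_poly_pCons e_def)
  moreover have "fls_const (1 - z) = 1 - fls_const z"
    using fls_minus_const[of 1 z] by simp
  then have "expand_poly (shift_poly [:- z, 1:]) = e + 1"
    by (simp add: expand_poly_pCons e_def shift_poly_def pcompose_pCons flip: fls_plus_const)
  ultimately have "poly_shift_ratio [:- z, 1:] = (e + \<rho> * e) / e"
    by (simp add: poly_shift_ratio_def \<rho>)
  also have "\<dots> = 1 + \<rho>" using \<open>e \<noteq> 0\<close> by (simp add: add_divide_distrib)
  finally show ?thesis by (simp add: \<rho>_def)
qed

lemma inverse_poly_shift_ratio_linear:
  "1 / poly_shift_ratio [:- z, 1:] = fps_to_fls (1 - recip_series (z - 1))"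
proof -
  have "(1 - recip_series (z - 1)) * (1 + recip_series z) = 1"
    using recip_series_diff[of z "z - 1"] by (simp add: algebra_simps)
  then have "fps_to_fls (1 - recip_series (z - 1)) * poly_shift_ratio [:- z, 1:] = 1"
    by (simp only: poly_shift_ratio_linear fls_times_fps_to_fls[symmetric] fps_one_to_fls)
  then show ?thesis using poly_shift_ratio_nonzero[of "[:- z, 1:]"] by (simp add: field_simps)
qed

lemma expand_ratfun_Fract:
  assumes "b \<noteq> 0"
  shows "expand_ratfun (Fract a b) = expand_poly a / expand_poly b"
proof -
  define q where "q = quot_of_fract (Fract a b)"
  have q: "snd q \<noteq> 0" by (simp add: q_def)
  have "Fract (fst q) (snd q) = Fract a b" by (simp add: q_def)
  then have "fst q * b = a * snd q" using assms q by (simp add: eq_fract)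
  then have "expand_poly (fst q) * expand_poly b = expand_poly a * expand_poly (snd q)"
    by (simp flip: expand_poly_mult)
  then show ?thesis using assms q by (simp add: expand_ratfun_def frac_eq_eq flip: q_def)
qed

lemma ratfun_shift_ratio_Fract:
  assumes "a \<noteq> 0" "b \<noteq> 0"
  shows "ratfun_shift_ratio (Fract a b) = poly_shift_ratio a / poly_shift_ratio b"
proof -
  define q where "q = quot_of_fract (Fract a b)"
  have q: "snd q \<noteq> 0" by (simp add: q_def)
  have "Fract (fst q) (snd q) = Fract a b" by (simp add: q_def)
  then have "shift_poly (fst q * b) = shift_poly (a * snd q)" using assms q by (simp add: eq_fract)
  then have "Fract (shift_poly (fst q)) (shift_poly (snd q)) = Fract (shift_poly a) (shift_poly b)"
    using assms q by (simp add: eq_fract(1) shift_poly_mult)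
  then have "shift_ratfun (Fract a b) = Fract (shift_poly a) (shift_poly b)"
    by (simp add: shift_ratfun_def flip: q_def)
  then show ?thesis
    using assms by (simp add: ratfun_shift_ratio_def expand_ratfun_Fract poly_shift_ratio_def)
qed

section \<open>Eigenvalues of the last diagonal series on subquotients\<close>

text \<open>
  In a vector module the basis vectors have multiplicity \<open>0\<close> or \<open>1\<close> of the weight \<open>\<epsilon>_n\<close>, in a
  covector module \<open>-1\<close> or \<open>0\<close>; the letter \<open>a\<close> is at the upper level if \<open>e_a\<close> has the larger of the two.
  The levels of the letters of a word are the binary digits of its rank, with the first letter the
  most significant, so that ranks compare the words lexicographically.
\<close>

fun upper_level :: "nat \<Rightarrow> factor \<Rightarrow> nat \<Rightarrow> bool" where
  "upper_level n (Vector z) a \<longleftrightarrow> a = n"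
| "upper_level n (Covector z) a \<longleftrightarrow> a \<noteq> n"

fun rank :: "nat \<Rightarrow> factor list \<Rightarrow> nat list \<Rightarrow> nat" where
  "rank n (F # Fs) (a # w) = (if upper_level n F a then 2 ^ length Fs else 0) + rank n Fs w"
| "rank n _ _ = 0"

lemma rank_less: "rank n Fs w < 2 ^ length Fs"
  by (induction n Fs w rule: rank.induct) auto

text \<open>
  \<open>T_nn(u)\<close> acts by a sum over paths \<open>n = k_0, k_1, ..., k_m = n\<close>.  At the first position where
  the path leaves \<open>n\<close> the level rises, and all letters before it stay, so the rank increases.
\<close>

lemma tensor_series_triangular:
  assumes "n \<ge> 1" "w' \<in> words n (length Fs)" "w \<in> words n (length Fs)"
    "tensor_series n Fs n n w' w \<noteq> 0"
  shows "w' = w \<or> rank n Fs w < rank n Fs w'"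
  using assms(2-)
proof (induction Fs arbitrary: w' w)
  case Nil
  then show ?case by (simp add: words_0)
next
  case (Cons F Fs)
  obtain a v b v' where w: "w = a # v" "w' = b # v'"
    and v: "v \<in> words n (length Fs)" "v' \<in> words n (length Fs)"
    using Cons.prems by (auto simp: words_Suc)
  have "\<exists>k\<in>{1..n}. factor_series F n k b a * tensor_series n Fs k n v' v \<noteq> 0"
    using Cons.prems(3) by (auto simp: w intro: ccontr elim!: sum.not_neutral_contains_not_neutral)
  then obtain k where k: "factor_series F n k b a \<noteq> 0" "tensor_series n Fs k n v' v \<noteq> 0"
    by auto
  show ?case
  proof (cases "k = n")
    case True
    then have "b = a" using k(1) by (cases F) (auto split: if_splits)
    then show ?thesis using Cons.IH[OF v(2,1)] k True by (auto simp: w)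
  next
    case False
    then have "upper_level n F b" "\<not> upper_level n F a"
      using k(1) by (cases F; auto split: if_splits)+
    then show ?thesis using rank_less[of n Fs v] by (simp add: w)
  qed
qed

lemma tensor_series_diagonal_Cons:
  assumes "n \<ge> 1"
  shows "tensor_series n (F # Fs) n n (a # w) (a # w)
    = factor_series F n n a a * tensor_series n Fs n n w w"
proof -
  have "tensor_series n (F # Fs) n n (a # w) (a # w)
      = (\<Sum>k\<in>{1..n}. if k = n then factor_series F n n a a * tensor_series n Fs n n w w else 0)"
    unfolding tensor_series.simps list.sel by (intro sum.cong refl) (cases F; auto)
  then show ?thesis using assms by simp
qed

text \<open>
  If \<open>d\<close> is the diagonal entry at the least word in the support of \<open>x\<close>, then \<open>T_nn^(r) - d_r\<close>
  removes this word from the support, while modulo \<open>N\<close> it multiplies \<open>x\<close> by \<open>A_r - d_r\<close>.  If \<open>A\<close> were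
  different from all diagonal entries, this would show that \<open>x\<close> vanishes modulo \<open>N\<close>.
\<close>

lemma eigenvalue_is_diagonal_entry:
  assumes n: "n \<ge> 1"
    and subM: "yangian_submodule fun_scale n (tensor_space n Fs) (tensor_action n Fs) M"
    and subN: "yangian_submodule fun_scale n (tensor_space n Fs) (tensor_action n Fs) N"
    and x: "x \<in> M" "x \<notin> N"
    and eig: "\<And>r. tensor_action n Fs n n r x - fun_scale (fps_nth A r) x \<in> N"
  shows "\<exists>w\<in>words n (length Fs). A = tensor_series n Fs n n w w"
proof (rule ccontr)
  assume no: "\<not> ?thesis"
  interpret yangian_module fun_scale n "tensor_space n Fs" "tensor_action n Fs"
    by (rule tensor_yangian_module)
  let ?T = "tensor_action n Fs n n" and ?W = "words n (length Fs)"
  let ?t = "tensor_series n Fs n n"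
  have nn: "n \<in> {1..n}" using n by simp
  have M: "subspace M" "M \<subseteq> tensor_space n Fs" "y \<in> M \<Longrightarrow> ?T r y \<in> M" for y r
    using subM nn unfolding yangian_submodule_def by blast+
  have N: "subspace N" "N \<subseteq> tensor_space n Fs" "y \<in> N \<Longrightarrow> ?T r y \<in> N" for y r
    using subN nn unfolding yangian_submodule_def by blast+
  have "y \<in> N"
    if "U \<subseteq> ?W" "\<And>w w'. w \<in> U \<Longrightarrow> w' \<in> ?W \<Longrightarrow> ?t w' w \<noteq> 0 \<Longrightarrow> w' \<in> U"
      "y \<in> M" "\<And>w. w \<notin> U \<Longrightarrow> y w = 0" "\<And>r. ?T r y - fun_scale (fps_nth A r) y \<in> N" for U y
    using finite_subset[OF that(1) finite_words] that
  proof (induction U arbitrary: y rule: finite_psubset_induct)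
    case (psubset U)
    show ?case
    proof (cases "U = {}")
      case True
      then have "y = 0" using psubset.prems by (simp add: fun_eq_iff)
      then show ?thesis by (simp only: subspace_0[OF N(1)])
    next
      case False
      define w0 where "w0 = arg_min_on (rank n Fs) U"
      have w0: "w0 \<in> U" "\<And>w. w \<in> U \<Longrightarrow> rank n Fs w0 \<le> rank n Fs w"
        using False psubset.hyps arg_min_if_finite(1)[of U "rank n Fs"]
          arg_min_least[of U _ "rank n Fs"] by (auto simp: w0_def)
      have "A \<noteq> ?t w0 w0" using no w0 psubset.prems by blast
      then obtain r where r: "fps_nth A r \<noteq> fps_nth (?t w0 w0) r" by (auto simp: fps_eq_iff)
      define d where "d = fps_nth (?t w0 w0) r"
      define y' where "y' = ?T r y - fun_scale d y"
      define m where "m = ?T r y - fun_scale (fps_nth A r) y"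
      have least: "w = w0" if "w \<in> U" "?t w0 w \<noteq> 0" for w
        using tensor_series_triangular[OF n, of w0 Fs w] w0 that psubset.prems(1) by fastforce
      have y': "y' = m + fun_scale (fps_nth A r - d) y"
        by (simp add: y'_def m_def scale_left_diff_distrib)
      have mN: "m \<in> N" unfolding m_def by (rule psubset.prems(5))
      have V: "m \<in> tensor_space n Fs" "y \<in> tensor_space n Fs"
        using mN N(2) psubset.prems(3) M(2) by auto
      have "y' \<in> N"
      proof (rule psubset.IH[of "U - {w0}"])
        show "U - {w0} \<subset> U" "U - {w0} \<subseteq> ?W"
          using w0 psubset.prems by auto
        show "y' \<in> M"
          unfolding y'_def
          by (intro subspace_diff[OF M(1)] subspace_scale[OF M(1)] M(3) psubset.prems)
        show "w' \<in> U - {w0}" if "w \<in> U - {w0}" "w' \<in> ?W" "?t w' w \<noteq> 0" for w w'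
          using least psubset.prems(2)[of w w'] that by auto
        show "y' w' = 0" if w': "w' \<notin> U - {w0}" for w'
        proof (cases "w' \<in> ?W")
          case False
          then have "y w' = 0" using psubset.prems(1,4) by blast
          then show ?thesis using False by (simp add: y'_def tensor_action_def fun_scale_def)
        next
          case True
          have "?T r y w' = (\<Sum>w\<in>?W. if w = w' then d * y w' else 0)"
            unfolding tensor_action_def if_P[OF True]
          proof (intro sum.cong refl)
            fix w assume "w \<in> ?W"
            show "fps_nth (?t w' w) r * y w = (if w = w' then d * y w' else 0)"
            proof (cases "w \<in> U")
              case False
              then show ?thesis using psubset.prems(4)[OF False] by auto
            next
              case wU: True
              show ?thesis
              proof (cases "w' = w0")
                case True
                then show ?thesis using least[OF wU] by (cases "?t w' w = 0") (auto simp: d_def)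
              next
                case False
                then have "w' \<notin> U" using w' by blast
                then have "?t w' w = 0" "w \<noteq> w'" using psubset.prems(2)[OF wU True] wU by blast+
                then show ?thesis by simp
              qed
            qed
          qed
          then show ?thesis using True by (simp add: y'_def fun_scale_def)
        qed
        show "?T s y' - fun_scale (fps_nth A s) y' \<in> N" for s
        proof -
          have "?T s y' - fun_scale (fps_nth A s) y' = (?T s m - fun_scale (fps_nth A s) m)
              + fun_scale (fps_nth A r - d) (?T s y - fun_scale (fps_nth A s) y)"
            unfolding y' using V nn
            by (simp add: T_add T_scale scale_mem scale_right_distrib scale_right_diff_distrib
                mult.commute)
          also have "\<dots> \<in> N"
            by (intro subspace_add[OF N(1)] subspace_diff[OF N(1)] subspace_scale[OF N(1)] N(3) mN
                psubset.prems)
          finally show ?thesis .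
        qed
      qed
      then have "fun_scale (fps_nth A r - d) y \<in> N"
        using subspace_diff[OF N(1) _ mN, of y'] by (simp add: y')
      then have "fun_scale (inverse (fps_nth A r - d)) (fun_scale (fps_nth A r - d) y) \<in> N"
        by (rule subspace_scale[OF N(1)])
      then show ?thesis using r by (simp add: d_def)
    qed
  qed
  from this[of ?W x] have "x \<in> N"
    using x(1) M(2) eig by (auto simp: tensor_space_def)
  then show False using x(2) by simp
qed

text \<open>A preimage of \<open>v\<close> in the tensor product is an eigenvector modulo the submodule \<open>N\<close>.\<close>

lemma subquotient_eigenvalue:
  assumes n: "n \<ge> 1"
    and sub: "isomorphic_to_subquotient n fun_scale (tensor_space n Fs) (tensor_action n Fs) scale V T"
    and mod: "yangian_module scale n V T"
    and v: "v \<in> V" "v \<noteq> 0" "\<And>r. T n n r v = scale (fps_nth A r) v"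
  shows "\<exists>w\<in>words n (length Fs). A = tensor_series n Fs n n w w"
proof -
  interpret M': yangian_module scale n V T by (rule mod)
  interpret yangian_module fun_scale n "tensor_space n Fs" "tensor_action n Fs"
    by (rule tensor_yangian_module)
  have nn: "n \<in> {1..n}" using n by simp
  from sub obtain M N \<phi> where
    M: "yangian_submodule fun_scale n (tensor_space n Fs) (tensor_action n Fs) M" and
    N: "yangian_submodule fun_scale n (tensor_space n Fs) (tensor_action n Fs) N" and
    bij: "bij_betw \<phi> ((\<lambda>x. x +o N) ` M) V" and
    add: "\<And>x y. x \<in> M \<Longrightarrow> y \<in> M \<Longrightarrow> \<phi> ((x + y) +o N) = \<phi> (x +o N) + \<phi> (y +o N)" and
    scl: "\<And>c x. x \<in> M \<Longrightarrow> \<phi> (fun_scale c x +o N) = scale c (\<phi> (x +o N))" and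
    act: "\<And>r x. x \<in> M \<Longrightarrow> \<phi> (tensor_action n Fs n n r x +o N) = T n n r (\<phi> (x +o N))"
    using nn unfolding isomorphic_to_subquotient_def isomorphic_to_quotient_def by blast
  have sM: "subspace M" "\<And>x r. x \<in> M \<Longrightarrow> tensor_action n Fs n n r x \<in> M"
    and sN: "subspace N"
    using M N nn unfolding yangian_submodule_def by blast+
  obtain x where x: "x \<in> M" "\<phi> (x +o N) = v"
    using bij v(1) unfolding bij_betw_def by (metis (no_types, lifting) imageE)
  have same_coset: "y - y' \<in> N" if "y \<in> M" "y' \<in> M" "\<phi> (y +o N) = \<phi> (y' +o N)" for y y'
  proof -
    have "y +o N = y' +o N"
      using bij that unfolding bij_betw_def inj_on_def by blast
    moreover have "y \<in> y +o N"
      using subspace_0[OF sN] by (auto simp: elt_set_plus_def intro!: bexI[of _ 0])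
    ultimately obtain m where "m \<in> N" "y = y' + m" by (auto simp: elt_set_plus_def)
    then show ?thesis by simp
  qed
  have zero: "\<phi> (0 +o N) = 0"
    using scl[OF subspace_0[OF sM(1)], of 0] by simp
  have "x \<notin> N"
  proof
    assume "x \<in> N"
    have "x +o N = 0 +o N"
    proof (intro set_eqI iffI)
      fix y assume "y \<in> x +o N"
      then show "y \<in> 0 +o N"
        using subspace_add[OF sN \<open>x \<in> N\<close>] by (auto simp: elt_set_plus_def)
    next
      fix y assume "y \<in> 0 +o N"
      then show "y \<in> x +o N"
        using subspace_diff[OF sN _ \<open>x \<in> N\<close>, of y]
        by (auto simp: elt_set_plus_def intro!: bexI[of _ "y - x"])
    qed
    then show False using x(2) zero v(2) by simp
  qed
  moreover have "tensor_action n Fs n n r x - fun_scale (fps_nth A r) x \<in> N" for r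
    by (intro same_coset sM(2) subspace_scale[OF sM(1)] x(1)) (simp add: act scl x v(3))
  ultimately show ?thesis
    using eigenvalue_is_diagonal_entry[OF n M N x(1)] by blast
qed

lemma diagonal_entry_vector:
  assumes "n \<ge> 1" "w \<in> words n (length zs)"
  shows "\<exists>Q. Q \<noteq> 0 \<and> fps_to_fls (tensor_series n (map Vector zs) n n w w) = poly_shift_ratio Q"
  using assms(2)
proof (induction zs arbitrary: w)
  case Nil
  then show ?case using poly_shift_ratio_const[of 1] by (intro exI[of _ "[:1:]"]) simp
next
  case (Cons z zs)
  then obtain a v where w: "w = a # v" "v \<in> words n (length zs)" by (auto simp: words_Suc)
  obtain Q where Q: "Q \<noteq> 0"
      "fps_to_fls (tensor_series n (map Vector zs) n n v v) = poly_shift_ratio Q"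
    using Cons.IH[OF w(2)] by blast
  show ?case
  proof (cases "a = n")
    case True
    then have "fps_to_fls (tensor_series n (map Vector (z # zs)) n n w w)
        = poly_shift_ratio ([:- z, 1:] * Q)"
      using assms(1) Q
      by (simp add: w tensor_series_diagonal_Cons poly_shift_ratio_mult poly_shift_ratio_linear
          fls_times_fps_to_fls del: tensor_series.simps mult_pCons_left)
    then show ?thesis using Q(1) by (intro exI[of _ "[:- z, 1:] * Q"]) (simp del: mult_pCons_left)
  next
    case False
    then show ?thesis
      using assms(1) Q by (auto simp: w tensor_series_diagonal_Cons simp del: tensor_series.simps)
  qed
qed

lemma diagonal_entry_factor:
  assumes "n \<ge> 1" "w \<in> words n (length Fs)"
  shows "\<exists>Q R. Q \<noteq> 0 \<and> R \<noteq> 0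
    \<and> fps_to_fls (tensor_series n Fs n n w w) = poly_shift_ratio Q / poly_shift_ratio R"
  using assms(2)
proof (induction Fs arbitrary: w)
  case Nil
  then show ?case
    using poly_shift_ratio_const[of 1] by (intro exI[of _ "[:1:]"]) simp
next
  case (Cons F Fs)
  then obtain a v where w: "w = a # v" "v \<in> words n (length Fs)" by (auto simp: words_Suc)
  obtain Q R where QR: "Q \<noteq> 0" "R \<noteq> 0"
      "fps_to_fls (tensor_series n Fs n n v v) = poly_shift_ratio Q / poly_shift_ratio R"
    using Cons.IH[OF w(2)] by blast
  have "\<exists>Q' R'. Q' \<noteq> 0 \<and> R' \<noteq> 0
      \<and> fps_to_fls (factor_series F n n a a) = poly_shift_ratio Q' / poly_shift_ratio R'"
  proof (cases "a = n")
    case False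
    then show ?thesis
      using poly_shift_ratio_const[of 1] by (intro exI[of _ "[:1:]"]) (cases F; simp)
  next
    case True
    show ?thesis
    proof (cases F)
      case (Vector z)
      then show ?thesis
        using True poly_shift_ratio_const[of 1] poly_shift_ratio_linear[of z]
        by (intro exI[of _ "[:- z, 1:]"] exI[of _ "[:1:]"]) simp
    next
      case (Covector z)
      then show ?thesis
        using True poly_shift_ratio_const[of 1] inverse_poly_shift_ratio_linear[of z]
        by (intro exI[of _ "[:1:]"] exI[of _ "[:- z, 1:]"]) simp
    qed
  qed
  then obtain Q' R' where QR': "Q' \<noteq> 0" "R' \<noteq> 0"
      "fps_to_fls (factor_series F n n a a) = poly_shift_ratio Q' / poly_shift_ratio R'"
    by blast
  have "fps_to_fls (tensor_series n (F # Fs) n n w w)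
      = poly_shift_ratio (Q' * Q) / poly_shift_ratio (R' * R)"
    by (simp only: w tensor_series_diagonal_Cons[OF assms(1)] fls_times_fps_to_fls QR(3) QR'(3)
        poly_shift_ratio_mult times_divide_times_eq)
  then show ?case
    using QR(1,2) QR'(1,2) by (intro exI[of _ "Q' * Q"] exI[of _ "R' * R"]) simp
qed

section \<open>Alternating tensors\<close>

text \<open>
  The series whose coefficients are the values of \<open>T_ij^(r) f\<close> at \<open>w'\<close>; eigenvalues can then be
  multiplied as series.
\<close>

definition series_action ::
  "nat \<Rightarrow> factor list \<Rightarrow> nat \<Rightarrow> nat \<Rightarrow> (nat list \<Rightarrow> complex) \<Rightarrow> nat list \<Rightarrow> complex fps" where
  "series_action n Fs i j f w' =
     (\<Sum>w\<in>words n (length Fs). tensor_series n Fs i j w' w * fps_const (f w))"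

lemma tensor_action_eq_series:
  "tensor_action n Fs i j r f w'
    = (if w' \<in> words n (length Fs) then fps_nth (series_action n Fs i j f w') r else 0)"
  by (simp add: tensor_action_def series_action_def fps_sum_nth)

lemma series_action_Nil: "series_action n [] i j f [] = (if i = j then fps_const (f []) else 0)"
  by (simp add: series_action_def words_0)

lemma series_action_Cons:
  "series_action n (F # Fs) i j f (b # w')
    = (\<Sum>a\<in>{1..n}. \<Sum>k\<in>{1..n}.
        factor_series F i k b a * series_action n Fs k j (\<lambda>w. f (a # w)) w')"
proof -
  have "series_action n (F # Fs) i j f (b # w')
      = (\<Sum>a\<in>{1..n}. \<Sum>w\<in>words n (length Fs). \<Sum>k\<in>{1..n}.
          factor_series F i k b a * (tensor_series n Fs k j w' w * fps_const (f (a # w))))"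
    by (simp add: series_action_def sum_words_Suc sum_distrib_right mult.assoc)
  also have "\<dots> = (\<Sum>a\<in>{1..n}. \<Sum>k\<in>{1..n}. \<Sum>w\<in>words n (length Fs).
          factor_series F i k b a * (tensor_series n Fs k j w' w * fps_const (f (a # w))))"
    by (intro sum.cong refl sum.swap)
  finally show ?thesis by (simp add: series_action_def sum_distrib_left)
qed

lemma series_action_Vector:
  assumes "i \<in> {1..n}" "b \<in> {1..n}"
  shows "series_action n (Vector z # Fs) i j f (b # w)
    = series_action n Fs i j (\<lambda>w. f (b # w)) w
      + (if b = i then recip_series z * (\<Sum>a\<in>{1..n}. series_action n Fs a j (\<lambda>w. f (a # w)) w) else 0)"
proof -
  let ?g = "\<lambda>k a. series_action n Fs k j (\<lambda>w. f (a # w)) w"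
  have "series_action n (Vector z # Fs) i j f (b # w)
      = (\<Sum>a\<in>{1..n}. \<Sum>k\<in>{1..n}. (if i = k then (if b = a then ?g i b else 0) else 0)
          + (if a = k then (if b = i then recip_series z * ?g a a else 0) else 0))"
    unfolding series_action_Cons by (intro sum.cong refl) (auto simp: algebra_simps)
  also have "\<dots> = (\<Sum>a\<in>{1..n}. (if b = a then ?g i b else 0)
          + (if b = i then recip_series z * ?g a a else 0))"
    using assms by (intro sum.cong refl) (simp add: sum.distrib)
  also have "\<dots> = ?g i b + (if b = i then recip_series z * (\<Sum>a\<in>{1..n}. ?g a a) else 0)"
    using assms by (simp add: sum.distrib sum_distrib_left)
  finally show ?thesis .
qed

lemma series_action_Covector:
  assumes "i \<in> {1..n}" "b \<in> {1..n}"
  shows "series_action n (Covector z # Fs) i j f (b # w)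
    = series_action n Fs i j (\<lambda>w. f (b # w)) w
      - recip_series (z - 1) * series_action n Fs b j (\<lambda>w. f (i # w)) w"
proof -
  let ?g = "\<lambda>k a. series_action n Fs k j (\<lambda>w. f (a # w)) w"
  have "series_action n (Covector z # Fs) i j f (b # w)
      = (\<Sum>a\<in>{1..n}. \<Sum>k\<in>{1..n}. (if i = k then (if b = a then ?g i b else 0) else 0)
          - (if b = k then (if i = a then recip_series (z - 1) * ?g b i else 0) else 0))"
    unfolding series_action_Cons by (intro sum.cong refl) (auto simp: algebra_simps)
  also have "\<dots> = (\<Sum>a\<in>{1..n}. (if b = a then ?g i b else 0)
          - (if i = a then recip_series (z - 1) * ?g b i else 0))"
    using assms by (intro sum.cong refl) (simp add: sum_subtractf)
  also have "\<dots> = ?g i b - recip_series (z - 1) * ?g b i"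
    using assms by (simp add: sum_subtractf)
  finally show ?thesis .
qed

definition alternating :: "(nat list \<Rightarrow> complex) \<Rightarrow> bool" where
  "alternating f \<longleftrightarrow> (\<forall>xs a b ys. f (xs @ b # a # ys) = - f (xs @ a # b # ys))"

lemma alternatingD: "alternating f \<Longrightarrow> f (xs @ b # a # ys) = - f (xs @ a # b # ys)"
  unfolding alternating_def by blast

lemma alternating_front: "alternating f \<Longrightarrow> f (b # a # ys) = - f (a # b # ys)"
  using alternatingD[of f "[]" b a ys] by simp

lemma alternating_Cons: "alternating f \<Longrightarrow> alternating (\<lambda>w. f (c # w))"
  unfolding alternating_def append_Cons[symmetric] by blast

lemma alternating_not_distinct:
  assumes "alternating f" "\<not> distinct w"
  shows "f w = 0"
proof -
  obtain xs y ys zs where w: "w = xs @ [y] @ ys @ [y] @ zs"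
    using not_distinct_decomp[OF assms(2)] by blast
  have front: "g (y # ys @ y # zs) = 0" if "alternating g" for g :: "nat list \<Rightarrow> complex" and ys
    using that
  proof (induction ys arbitrary: g)
    case Nil
    then have "2 * g (y # y # zs) = 0"
      using alternating_front[of g y y zs] by (simp only: mult_2 eq_neg_iff_add_eq_0)
    then show ?case by simp
  next
    case (Cons c ys)
    then show ?case
      using alternating_front[of g y c "ys @ y # zs"] Cons.IH[OF alternating_Cons, of g c] by simp
  qed
  have "alternating (\<lambda>w. f (xs @ w))"
    using assms(1) unfolding alternating_def append_assoc[symmetric] by blast
  from front[OF this, of ys] show ?thesis by (simp add: w)
qed

text \<open>The value at a word of \<open>E_ij f\<close>: the sum over all ways to replace one letter \<open>i\<close> by \<open>j\<close>.\<close>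

fun matrix_unit :: "nat \<Rightarrow> nat \<Rightarrow> (nat list \<Rightarrow> complex) \<Rightarrow> nat list \<Rightarrow> complex" where
  "matrix_unit i j f [] = 0"
| "matrix_unit i j f (a # w) = (if a = i then f (j # w) else 0) + matrix_unit i j (\<lambda>v. f (a # v)) w"

lemma matrix_unit_uminus: "matrix_unit i j (\<lambda>v. - f v) w = - matrix_unit i j f w"
  by (induction w arbitrary: f) simp_all

lemma matrix_unit_diagonal: "matrix_unit i i f w = of_nat (count_list w i) * f w"
  by (induction w arbitrary: f) (simp_all add: algebra_simps)

lemma matrix_unit_nonzero:
  "matrix_unit i j f w \<noteq> 0 \<Longrightarrow> \<exists>xs ys. w = xs @ i # ys \<and> f (xs @ j # ys) \<noteq> 0"
proof (induction w arbitrary: f)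
  case (Cons a w)
  show ?case
  proof (cases "a = i \<and> f (j # w) \<noteq> 0")
    case True
    then show ?thesis by (intro exI[of _ "[]"] exI[of _ w]) simp
  next
    case False
    then have "matrix_unit i j (\<lambda>v. f (a # v)) w \<noteq> 0"
      using Cons.prems by (auto split: if_splits)
    then obtain xs ys where "w = xs @ i # ys" "f (a # xs @ j # ys) \<noteq> 0"
      using Cons.IH by blast
    then show ?thesis by (intro exI[of _ "a # xs"] exI[of _ ys]) simp
  qed
qed simp

lemma alternating_matrix_unit:
  assumes "alternating f"
  shows "alternating (matrix_unit i j f)"
proof -
  have "matrix_unit i j f (xs @ b # a # ys) = - matrix_unit i j f (xs @ a # b # ys)" for xs a b ys
    using assms
  proof (induction xs arbitrary: f)
    case Nil
    have "(\<lambda>v. f (b # a # v)) = (\<lambda>v. - f (a # b # v))"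
      using alternating_front[OF Nil] by (intro ext)
    note swap = this alternating_front[OF Nil, of j a ys] alternating_front[OF Nil, of b j ys]
    show ?case
      unfolding append_Nil matrix_unit.simps swap matrix_unit_uminus by simp
  next
    case (Cons c xs)
    show ?case
      using alternatingD[OF Cons.prems, of "j # xs" b a ys]
      by (simp only: append_Cons matrix_unit.simps Cons.IH[OF alternating_Cons[OF Cons.prems]]
          minus_add_distrib) simp
  qed
  then show ?thesis unfolding alternating_def by blast
qed

text \<open>
  Both identities exchange the first letter with another one and use that the values of an
  alternating function change their sign.
\<close>

lemma alternating_trace:
  assumes "alternating f" "w \<in> words n m"
  shows "(\<Sum>c\<in>{1..n}. matrix_unit c j (\<lambda>v. f (c # v)) w) = - of_nat m * f (j # w)"
  using assms
proof (induction w arbitrary: f m)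
  case Nil
  then show ?case by (auto simp: words_def)
next
  case (Cons a w)
  then obtain m' where m: "m = Suc m'" "a \<in> {1..n}" "w \<in> words n m'"
    by (cases m) (auto simp: words_def)
  have swap: "matrix_unit c j (\<lambda>v. f (c # a # v)) w = - matrix_unit c j (\<lambda>v. f (a # c # v)) w" for c
  proof -
    have "(\<lambda>v. f (c # a # v)) = (\<lambda>v. - f (a # c # v))"
      using alternating_front[OF Cons.prems(1)] by (intro ext)
    then show ?thesis by (simp add: matrix_unit_uminus)
  qed
  have "(\<Sum>c\<in>{1..n}. matrix_unit c j (\<lambda>v. f (c # v)) (a # w))
      = (\<Sum>c\<in>{1..n}. if a = c then f (a # j # w) else 0)
        - (\<Sum>c\<in>{1..n}. matrix_unit c j (\<lambda>v. f (a # c # v)) w)"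
    unfolding sum_subtractf[symmetric] by (intro sum.cong refl) (auto simp: swap)
  also have "(\<Sum>c\<in>{1..n}. if a = c then f (a # j # w) else 0) = - f (j # a # w)"
    using m(2) alternating_front[OF Cons.prems(1), of a j w] by simp
  also have "(\<Sum>c\<in>{1..n}. matrix_unit c j (\<lambda>v. f (a # c # v)) w) = - of_nat m' * f (a # j # w)"
    by (rule Cons.IH[OF alternating_Cons[OF Cons.prems(1)] m(3)])
  also have "f (a # j # w) = - f (j # a # w)"
    by (rule alternating_front[OF Cons.prems(1)])
  finally show ?case by (simp add: m(1) algebra_simps)
qed

lemma alternating_exchange:
  assumes "alternating f"
  shows "matrix_unit j b (\<lambda>v. f (i # v)) w = - matrix_unit j i (\<lambda>v. f (b # v)) w"
  using assms
proof (induction w arbitrary: f)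
  case (Cons a w)
  have swap: "matrix_unit j c (\<lambda>v. f (d # a # v)) w = - matrix_unit j c (\<lambda>v. f (a # d # v)) w" for c d
  proof -
    have "(\<lambda>v. f (d # a # v)) = (\<lambda>v. - f (a # d # v))"
      using alternating_front[OF Cons.prems(1)] by (intro ext)
    then show ?thesis by (simp add: matrix_unit_uminus)
  qed
  show ?case
    using Cons.IH[OF alternating_Cons[OF Cons.prems], of a] alternating_front[OF Cons.prems, of i b w]
    by (simp add: swap)
qed simp

text \<open>
  Consecutive parameters in decreasing order, for which the alternating tensors form a submodule.
\<close>

primrec parameter_string :: "complex \<Rightarrow> nat \<Rightarrow> complex list" where
  "parameter_string z 0 = []"
| "parameter_string z (Suc m) = (z + of_nat m) # parameter_string z m"

lemma length_parameter_string [simp]: "length (parameter_string z m) = m"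
  by (induction m) auto

text \<open>
  On alternating tensors a string of vector modules acts by the evaluation formula
  \<open>T_ij(u) = \<delta>_ij + E_ij / (u - z)\<close>.  In the inductive step the first factor contributes
  \<open>(1 - m / (u - z)) / (u - z - m) = 1 / (u - z)\<close>, where \<open>m\<close> is the number of the other factors.
\<close>

lemma vector_string_alternating:
  assumes "alternating f" "i \<in> {1..n}" "j \<in> {1..n}" "w \<in> words n m"
  shows "series_action n (map Vector (parameter_string z m)) i j f w
    = (if i = j then fps_const (f w) else 0) + recip_series z * fps_const (matrix_unit i j f w)"
  using assms
proof (induction m arbitrary: i f w)
  case 0
  then show ?case by (simp add: words_0 series_action_Nil)
next
  case (Suc m)
  obtain b v where w: "w = b # v" and b: "b \<in> {1..n}" and v: "v \<in> words n m"
    using Suc.prems(4) by (auto simp: words_Suc)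
  let ?Fs = "map Vector (parameter_string z m)"
  let ?\<rho> = "recip_series z" and ?\<rho>' = "recip_series (z + of_nat m)"
  have IH: "series_action n ?Fs a j (\<lambda>w. f (c # w)) v
      = (if a = j then fps_const (f (c # v)) else 0)
        + ?\<rho> * fps_const (matrix_unit a j (\<lambda>w. f (c # w)) v)" if "a \<in> {1..n}" for a c
    by (rule Suc.IH[OF alternating_Cons[OF Suc.prems(1)] that Suc.prems(3) v])
  have "(\<Sum>a\<in>{1..n}. series_action n ?Fs a j (\<lambda>w. f (a # w)) v)
      = (\<Sum>a\<in>{1..n}. if a = j then fps_const (f (j # v)) else 0)
        + ?\<rho> * fps_const (\<Sum>a\<in>{1..n}. matrix_unit a j (\<lambda>w. f (a # w)) v)"
    unfolding fps_const_sum sum_distrib_left sum.distrib[symmetric]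
    by (intro sum.cong refl) (simp add: IH)
  also have "(\<Sum>a\<in>{1..n}. if a = j then fps_const (f (j # v)) else 0) = fps_const (f (j # v))"
    using Suc.prems(3) by simp
  also have "(\<Sum>a\<in>{1..n}. matrix_unit a j (\<lambda>w. f (a # w)) v) = - of_nat m * f (j # v)"
    by (rule alternating_trace[OF Suc.prems(1) v])
  finally have "(\<Sum>a\<in>{1..n}. series_action n ?Fs a j (\<lambda>w. f (a # w)) v)
      = fps_const (f (j # v)) + ?\<rho> * fps_const (- of_nat m * f (j # v))" .
  then have trace: "?\<rho>' * (\<Sum>a\<in>{1..n}. series_action n ?Fs a j (\<lambda>w. f (a # w)) v)
      = (?\<rho>' - fps_const (of_nat m) * (?\<rho>' * ?\<rho>)) * fps_const (f (j # v))"
    by (simp only:) (simp add: algebra_simps flip: fps_const_mult fps_const_neg)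
  have "?\<rho>' - fps_const (of_nat m) * (?\<rho>' * ?\<rho>) = ?\<rho>"
    using recip_series_diff[of "z + of_nat m" z] by (simp add: algebra_simps)
  note trace = trace[unfolded this]
  show ?case
    unfolding w parameter_string.simps list.map series_action_Vector[OF Suc.prems(2) b] trace
    by (simp add: IH[OF Suc.prems(2)] algebra_simps flip: fps_const_add)
qed

text \<open>
  A string of covector modules acts in the same way by \<open>\<delta>_ij - E_ji / (u - c)\<close>, where \<open>c\<close> belongs
  to the first factor.  Adding a factor with \<open>c + 1\<close> changes the coefficient of \<open>E_ji\<close> by the
  factor \<open>1 + 1 / (u - c - 1)\<close>, which turns \<open>1 / (u - c)\<close> into \<open>1 / (u - c - 1)\<close>.
\<close>

lemma covector_string_alternating:
  assumes "alternating f" "i \<in> {1..n}" "j \<in> {1..n}" "w \<in> words n m"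
  shows "series_action n (map Covector (parameter_string z m)) i j f w
    = (if i = j then fps_const (f w) else 0)
      - recip_series (z + of_nat m - 2) * fps_const (matrix_unit j i f w)"
  using assms
proof (induction m arbitrary: i f w)
  case 0
  then show ?case by (simp add: words_0 series_action_Nil)
next
  case (Suc m)
  obtain b v where w: "w = b # v" and b: "b \<in> {1..n}" and v: "v \<in> words n m"
    using Suc.prems(4) by (auto simp: words_Suc)
  let ?Fs = "map Covector (parameter_string z m)"
  let ?\<rho> = "recip_series (z + of_nat m - 2)" and ?\<rho>' = "recip_series (z + of_nat m - 1)"
  have IH: "series_action n ?Fs a j (\<lambda>w. f (c # w)) v
      = (if a = j then fps_const (f (c # v)) else 0)
        - ?\<rho> * fps_const (matrix_unit j a (\<lambda>w. f (c # w)) v)" if "a \<in> {1..n}" for a c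
    by (rule Suc.IH[OF alternating_Cons[OF Suc.prems(1)] that Suc.prems(3) v])
  have rho: "?\<rho>' = ?\<rho> + ?\<rho>' * ?\<rho>"
    using recip_series_diff[of "z + of_nat m - 1" "z + of_nat m - 2"] by (simp add: algebra_simps)
  have "series_action n (map Covector (parameter_string z (Suc m))) i j f w
      = (if i = j then fps_const (f w) else 0)
        - (?\<rho> + ?\<rho>' * ?\<rho>) * fps_const (matrix_unit j i (\<lambda>w. f (b # w)) v)
        - ?\<rho>' * (if b = j then fps_const (f (i # v)) else 0)"
    unfolding w parameter_string.simps list.map series_action_Covector[OF Suc.prems(2) b]
      IH[OF Suc.prems(2)] IH[OF b] alternating_exchange[OF Suc.prems(1), of j b i v]
    by (simp add: algebra_simps flip: fps_const_neg)
  also have "\<dots> = (if i = j then fps_const (f w) else 0) - ?\<rho>' * fps_const (matrix_unit j i f w)"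
    unfolding rho[symmetric] by (simp add: w algebra_simps flip: fps_const_add)
  finally show ?case by (simp add: algebra_simps)
qed

primrec vandermonde :: "nat list \<Rightarrow> complex" where
  "vandermonde [] = 1"
| "vandermonde (a # w) = prod_list (map (\<lambda>b. of_nat b - of_nat a) w) * vandermonde w"

lemma vandermonde_nonzero: "distinct w \<Longrightarrow> vandermonde w \<noteq> 0"
  by (induction w) (auto simp: prod_list_zero_iff)

lemma vandermonde_swap: "vandermonde (xs @ b # a # ys) = - vandermonde (xs @ a # b # ys)"
  by (induction xs) (simp_all add: algebra_simps)

text \<open>
  The antisymmetrization of \<open>e_1 \<otimes> ... \<otimes> e_k\<close> up to a factor: the Vandermonde product vanishes at
  words with repeated letters, and its values at the permutations of \<open>1, ..., k\<close> are proportional to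
  their signs.
\<close>

definition top_form :: "nat \<Rightarrow> nat list \<Rightarrow> complex" where
  "top_form k w = (if w \<in> words k k then vandermonde w else 0)"

lemma alternating_top_form: "alternating (top_form k)"
proof -
  have "top_form k (xs @ b # a # ys) = - top_form k (xs @ a # b # ys)" for xs a b ys
    using vandermonde_swap[of xs b a ys] by (auto simp: top_form_def words_def)
  then show ?thesis unfolding alternating_def by blast
qed

lemma top_form_nonzeroD:
  assumes "top_form k w \<noteq> 0"
  shows "distinct w" "set w = {1..k}"
proof -
  show "distinct w" using alternating_not_distinct[OF alternating_top_form] assms by blast
  then have "card (set w) = length w" by (simp add: distinct_card)
  moreover have "w \<in> words k k" using assms by (auto simp: top_form_def split: if_splits)
  ultimately show "set w = {1..k}" by (intro card_subset_eq) (auto simp: words_def)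
qed

lemma top_form_nonzero: "top_form k [1..<Suc k] \<noteq> 0"
  using vandermonde_nonzero[of "[1..<Suc k]"] by (auto simp: top_form_def words_def)

lemma matrix_unit_top_form_diagonal:
  assumes "i \<ge> 1"
  shows "matrix_unit i i (top_form k) w = (if i \<le> k then top_form k w else 0)"
proof (cases "top_form k w = 0")
  case False
  from top_form_nonzeroD[OF this] have "count_list w i = (if i \<le> k then 1 else 0)"
    using assms by (simp add: count_list_eq_length_filter distinct_length_filter)
  then show ?thesis by (simp add: matrix_unit_diagonal)
qed (simp add: matrix_unit_diagonal)

text \<open>
  Let \<open>\<omega>\<close> be the top form.  A word where \<open>E_ij \<omega>\<close> does not vanish has distinct letters, \<open>i\<close> among
  them, and the replacement of \<open>i\<close> by \<open>j\<close> leads to a word in the support of \<open>\<omega>\<close>.  But the words in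
  the support consist of \<open>1, ..., k\<close>: they do not contain \<open>j\<close> if \<open>j > k\<close>, and they contain \<open>i\<close>, which
  has been replaced, if \<open>i \<le> k\<close>.
\<close>

lemma matrix_unit_top_form_off_diagonal:
  assumes "i \<noteq> j" "i \<ge> 1" "i \<le> k \<or> j > k"
  shows "matrix_unit i j (top_form k) w = 0"
proof (rule ccontr)
  assume nz: "\<not> ?thesis"
  then obtain xs ys where w: "w = xs @ i # ys" "top_form k (xs @ j # ys) \<noteq> 0"
    using matrix_unit_nonzero by blast
  have "distinct w"
    using alternating_not_distinct[OF alternating_matrix_unit[OF alternating_top_form]] nz by blast
  moreover have letters: "set (xs @ j # ys) = {1..k}" by (rule top_form_nonzeroD[OF w(2)])
  moreover have "j \<in> {1..k}" unfolding letters[symmetric] by simp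
  ultimately show False using w(1) assms by auto
qed

section \<open>Highest weight vectors in tensor products\<close>

definition weight_vector ::
  "nat \<Rightarrow> factor list \<Rightarrow> (nat \<Rightarrow> complex fps) \<Rightarrow> (nat list \<Rightarrow> complex) \<Rightarrow> bool" where
  "weight_vector n Fs A f \<longleftrightarrow> f \<in> tensor_space n Fs \<and> f \<noteq> 0 \<and>
     (\<forall>i\<in>{1..n}. \<forall>j\<in>{1..n}. \<forall>w\<in>words n (length Fs). i \<le> j \<longrightarrow>
        series_action n Fs i j f w = (if i = j then A i * fps_const (f w) else 0))"

lemma weight_vector_imp_hw_vector:
  assumes "weight_vector n Fs A f"
  shows "yangian_module.hw_vector fun_scale n (tensor_space n Fs) (tensor_action n Fs) A f"
proof -
  interpret yangian_module fun_scale n "tensor_space n Fs" "tensor_action n Fs"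
    by (rule tensor_yangian_module)
  show ?thesis
    using assms unfolding hw_vector_def weight_vector_def
    by (auto simp: fun_eq_iff tensor_action_eq_series fun_scale_def tensor_space_def)
qed

lemma top_form_in_tensor_space:
  assumes "k \<le> n" "length Fs = k"
  shows "top_form k \<in> tensor_space n Fs"
  using assms by (auto simp: tensor_space_def top_form_def words_def)

lemma weight_vector_vector_string:
  assumes "k \<le> n"
  shows "weight_vector n (map Vector (parameter_string z k))
    (\<lambda>i. if i \<le> k then 1 + recip_series z else 1) (top_form k)"
  unfolding weight_vector_def
proof (intro conjI ballI impI)
  show "top_form k \<in> tensor_space n (map Vector (parameter_string z k))"
    using assms by (simp add: top_form_in_tensor_space)
  show "top_form k \<noteq> 0" using top_form_nonzero[of k] by (metis zero_fun_apply)
  fix i j w assume *: "i \<in> {1..n}" "j \<in> {1..n}"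
    "w \<in> words n (length (map Vector (parameter_string z k)))" "i \<le> j"
  then have w: "w \<in> words n k" by simp
  show "series_action n (map Vector (parameter_string z k)) i j (top_form k) w
      = (if i = j then (if i \<le> k then 1 + recip_series z else 1) * fps_const (top_form k w) else 0)"
    unfolding vector_string_alternating[OF alternating_top_form *(1,2) w]
    using * by (auto simp: matrix_unit_top_form_diagonal matrix_unit_top_form_off_diagonal algebra_simps)
qed

lemma weight_vector_covector_string:
  "weight_vector n (map Covector (parameter_string z n))
    (\<lambda>i. 1 - recip_series (z + of_nat n - 2)) (top_form n)"
  unfolding weight_vector_def
proof (intro conjI ballI impI)
  show "top_form n \<in> tensor_space n (map Covector (parameter_string z n))"
    by (simp add: top_form_in_tensor_space)
  show "top_form n \<noteq> 0" using top_form_nonzero[of n] by (metis zero_fun_apply)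
  fix i j w assume *: "i \<in> {1..n}" "j \<in> {1..n}"
    "w \<in> words n (length (map Covector (parameter_string z n)))" "i \<le> j"
  then have w: "w \<in> words n n" by simp
  show "series_action n (map Covector (parameter_string z n)) i j (top_form n) w
      = (if i = j then (1 - recip_series (z + of_nat n - 2)) * fps_const (top_form n w) else 0)"
    unfolding covector_string_alternating[OF alternating_top_form *(1,2) w]
    using * by (auto simp: matrix_unit_top_form_diagonal matrix_unit_top_form_off_diagonal algebra_simps)
qed

lemma sum_words_append:
  "(\<Sum>w\<in>words n (m + m'). g w) = (\<Sum>x\<in>words n m. \<Sum>y\<in>words n m'. g (x @ y))"
  by (induction m arbitrary: g) (simp_all add: words_0 sum_words_Suc)

lemma tensor_series_append:
  assumes "i \<in> {1..n}" "length x' = length Fs" "length x = length Fs"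
  shows "tensor_series n (Fs @ Gs) i j (x' @ y') (x @ y)
    = (\<Sum>k\<in>{1..n}. tensor_series n Fs i k x' x * tensor_series n Gs k j y' y)"
  using assms
proof (induction Fs arbitrary: i x' x)
  case Nil
  have "(\<Sum>k\<in>{1..n}. (if i = k then 1 else 0) * tensor_series n Gs k j y' y)
      = (\<Sum>k\<in>{1..n}. if i = k then tensor_series n Gs k j y' y else 0)"
    by (intro sum.cong refl) auto
  then show ?case using Nil by simp
next
  case (Cons F Fs)
  obtain a u where x: "x = a # u" using Cons.prems by (cases x) auto
  obtain b u' where x': "x' = b # u'" using Cons.prems by (cases x') auto
  have "tensor_series n ((F # Fs) @ Gs) i j (x' @ y') (x @ y)
      = (\<Sum>k\<in>{1..n}. factor_series F i k b a
          * (\<Sum>l\<in>{1..n}. tensor_series n Fs k l u' u * tensor_series n Gs l j y' y))"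
    using Cons.prems Cons.IH by (simp add: x x')
  also have "\<dots> = (\<Sum>k\<in>{1..n}. \<Sum>l\<in>{1..n}.
      (factor_series F i k b a * tensor_series n Fs k l u' u) * tensor_series n Gs l j y' y)"
    by (simp add: sum_distrib_left mult.assoc)
  also have "\<dots> = (\<Sum>l\<in>{1..n}. \<Sum>k\<in>{1..n}.
      (factor_series F i k b a * tensor_series n Fs k l u' u) * tensor_series n Gs l j y' y)"
    by (rule sum.swap)
  also have "\<dots> = (\<Sum>l\<in>{1..n}. tensor_series n (F # Fs) i l x' x * tensor_series n Gs l j y' y)"
    by (simp add: x x' sum_distrib_right)
  finally show ?case .
qed

definition tensor_vector :: "nat \<Rightarrow> (nat list \<Rightarrow> complex) \<Rightarrow> (nat list \<Rightarrow> complex) \<Rightarrow> nat list \<Rightarrow> complex"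
  where "tensor_vector m f g w = f (take m w) * g (drop m w)"

lemma series_action_tensor:
  assumes "i \<in> {1..n}" "x \<in> words n (length Fs)"
  shows "series_action n (Fs @ Gs) i j (tensor_vector (length Fs) f g) (x @ y)
    = (\<Sum>k\<in>{1..n}. series_action n Fs i k f x * series_action n Gs k j g y)"
proof -
  have len: "length v = length Fs" if "v \<in> words n (length Fs)" for v
    using that by (simp add: words_def)
  have "series_action n (Fs @ Gs) i j (tensor_vector (length Fs) f g) (x @ y)
      = (\<Sum>u\<in>words n (length Fs). \<Sum>v\<in>words n (length Gs). \<Sum>k\<in>{1..n}.
          (tensor_series n Fs i k x u * fps_const (f u)) * (tensor_series n Gs k j y v * fps_const (g v)))"
    unfolding series_action_def length_append sum_words_append
    using assms
    by (intro sum.cong refl)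
      (simp add: tensor_series_append len tensor_vector_def sum_distrib_right sum_distrib_left mult_ac
        flip: fps_const_mult)
  also have "\<dots> = (\<Sum>u\<in>words n (length Fs). \<Sum>k\<in>{1..n}. \<Sum>v\<in>words n (length Gs).
          (tensor_series n Fs i k x u * fps_const (f u)) * (tensor_series n Gs k j y v * fps_const (g v)))"
    by (intro sum.cong refl sum.swap)
  also have "\<dots> = (\<Sum>k\<in>{1..n}. \<Sum>u\<in>words n (length Fs). \<Sum>v\<in>words n (length Gs).
          (tensor_series n Fs i k x u * fps_const (f u)) * (tensor_series n Gs k j y v * fps_const (g v)))"
    by (rule sum.swap)
  finally show ?thesis by (simp add: series_action_def sum_product)
qed

text \<open>In \<open>\<Sum>k. T_ik(u) f \<otimes> T_kj(u) g\<close> the terms with \<open>i < k\<close> and those with \<open>k < j\<close> vanish.\<close>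

lemma weight_vector_tensor:
  assumes f: "weight_vector n Fs A f" and g: "weight_vector n Gs B g"
  shows "weight_vector n (Fs @ Gs) (\<lambda>i. A i * B i) (tensor_vector (length Fs) f g)"
  unfolding weight_vector_def
proof (intro conjI ballI impI)
  let ?h = "tensor_vector (length Fs) f g"
  show "?h \<in> tensor_space n (Fs @ Gs)"
    unfolding tensor_space_def
  proof (clarsimp, rule ccontr)
    fix w assume w: "w \<notin> words n (length Fs + length Gs)" and "?h w \<noteq> 0"
    then have "f (take (length Fs) w) \<noteq> 0" "g (drop (length Fs) w) \<noteq> 0"
      by (simp_all add: tensor_vector_def)
    then have "take (length Fs) w \<in> words n (length Fs)" "drop (length Fs) w \<in> words n (length Gs)"
      using f g by (auto simp: weight_vector_def tensor_space_def)
    then have "take (length Fs) w @ drop (length Fs) w \<in> words n (length Fs + length Gs)"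
      unfolding words_def by (auto simp del: append_take_drop_id length_take length_drop)
    then show False using w by simp
  qed
  obtain x where x: "f x \<noteq> 0" using f by (auto simp: weight_vector_def fun_eq_iff)
  obtain y where y: "g y \<noteq> 0" using g by (auto simp: weight_vector_def fun_eq_iff)
  have "length x = length Fs"
    using f x by (auto simp: weight_vector_def tensor_space_def words_def)
  then have "?h (x @ y) \<noteq> 0" using x y by (simp add: tensor_vector_def)
  then show "?h \<noteq> 0" by (metis zero_fun_apply)
  fix i j w assume *: "i \<in> {1..n}" "j \<in> {1..n}" "w \<in> words n (length (Fs @ Gs))" "i \<le> j"
  define x y where "x = take (length Fs) w" and "y = drop (length Fs) w"
  have w: "w = x @ y" and x: "x \<in> words n (length Fs)" and y: "y \<in> words n (length Gs)"
    using *(3) set_take_subset[of "length Fs" w] set_drop_subset[of "length Fs" w]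
    by (auto simp: x_def y_def words_def)
  have len: "length x = length Fs" using x by (simp add: words_def)
  have "series_action n Fs i k f x * series_action n Gs k j g y
      = (if k = i then (if i = j then A i * fps_const (f x) * (B i * fps_const (g y)) else 0) else 0)"
    if "k \<in> {1..n}" for k
  proof (cases k i rule: linorder_cases)
    case less
    then have "series_action n Gs k j g y = 0"
      using g that *(2,4) y unfolding weight_vector_def by auto
    then show ?thesis using less by simp
  next
    case equal
    then show ?thesis using f g *(1,2,4) x y unfolding weight_vector_def by auto
  next
    case greater
    then have "series_action n Fs i k f x = 0"
      using f that *(1) x unfolding weight_vector_def by auto
    then show ?thesis using greater by simp
  qed
  then have "series_action n (Fs @ Gs) i j ?h w
      = (if i = j then A i * fps_const (f x) * (B i * fps_const (g y)) else 0)"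
    unfolding w series_action_tensor[OF *(1) x] using *(1) by simp
  then show "series_action n (Fs @ Gs) i j ?h w = (if i = j then A i * B i * fps_const (?h w) else 0)"
    by (simp add: w tensor_vector_def len mult_ac flip: fps_const_mult)
qed

section \<open>Polynomial and rational modules\<close>

text \<open>
  The eigenvalues are taken as Laurent series, in which the quotients \<open>Q(u + 1) / Q(u)\<close> are formed.
\<close>

definition realized :: "nat \<Rightarrow> factor set \<Rightarrow> (nat \<Rightarrow> complex fls) \<Rightarrow> bool" where
  "realized n S L \<longleftrightarrow> (\<exists>Fs f A. set Fs \<subseteq> S \<and> weight_vector n Fs A f \<and>
     (\<forall>i\<in>{1..n}. fps_to_fls (A i) = L i))"

lemma realizedI:
  "set Fs \<subseteq> S \<Longrightarrow> weight_vector n Fs A f \<Longrightarrow> (\<And>i. i \<in> {1..n} \<Longrightarrow> fps_to_fls (A i) = L i) \<Longrightarrow>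
    realized n S L"
  unfolding realized_def by blast

lemma realized_cong: "(\<And>i. i \<in> {1..n} \<Longrightarrow> L i = L' i) \<Longrightarrow> realized n S L \<Longrightarrow> realized n S L'"
  unfolding realized_def by metis

lemma realized_mono: "S \<subseteq> S' \<Longrightarrow> realized n S L \<Longrightarrow> realized n S' L"
  unfolding realized_def by (meson subset_trans)

lemma realized_one: "realized n S (\<lambda>_. 1)"
proof (rule realizedI)
  show "weight_vector n [] (\<lambda>_. 1) (\<lambda>w. if w = [] then 1 else 0)"
    by (auto simp: weight_vector_def tensor_space_def words_0 series_action_Nil fun_eq_iff)
qed auto

lemma realized_mult:
  assumes "realized n S L" "realized n S M"
  shows "realized n S (\<lambda>i. L i * M i)"
proof -
  from assms obtain Fs f A Gs g B where
    "set Fs \<subseteq> S" "weight_vector n Fs A f" "\<And>i. i \<in> {1..n} \<Longrightarrow> fps_to_fls (A i) = L i"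
    "set Gs \<subseteq> S" "weight_vector n Gs B g" "\<And>i. i \<in> {1..n} \<Longrightarrow> fps_to_fls (B i) = M i"
    unfolding realized_def by metis
  note * = this
  show ?thesis
  proof (rule realizedI)
    show "set (Fs @ Gs) \<subseteq> S" using *(1,4) by simp
    show "weight_vector n (Fs @ Gs) (\<lambda>i. A i * B i) (tensor_vector (length Fs) f g)"
      by (rule weight_vector_tensor[OF *(2,5)])
    show "fps_to_fls (A i * B i) = L i * M i" if "i \<in> {1..n}" for i
      by (simp only: fls_times_fps_to_fls *(3,6)[OF that])
  qed
qed

text \<open>
  As \<open>\<complex>\<close> is algebraically closed, a linear factor \<open>u - z\<close> can be split off until the polynomial is
  constant.
\<close>

lemma realized_polynomial:
  assumes "P \<noteq> 0"
    and linear: "\<And>z. realized n S (\<lambda>i. h i (poly_shift_ratio [:- z, 1:]))"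
    and one: "\<And>i. h i 1 = 1" and mult: "\<And>i x y. h i (x * y) = h i x * h i y"
  shows "realized n S (\<lambda>i. h i (poly_shift_ratio P))"
  using assms(1)
proof (induction "degree P" arbitrary: P)
  case 0
  then obtain c where "P = [:c:]" "c \<noteq> 0" using degree_eq_zeroE by (metis pCons_0_0)
  then show ?case using realized_one by (simp add: poly_shift_ratio_const one)
next
  case (Suc d)
  then have "\<not> constant (poly P)" by (simp add: constant_degree)
  then obtain z where "poly P z = 0" using fundamental_theorem_of_algebra by blast
  then obtain R where R: "P = [:- z, 1:] * R" by (auto simp: poly_eq_0_iff_dvd dvd_def)
  then have "R \<noteq> 0" using Suc.prems by auto
  moreover have "d = degree R"
    using Suc.hyps(2) \<open>R \<noteq> 0\<close> unfolding R by (subst (asm) degree_mult_eq) auto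
  ultimately show ?case
    using realized_mult[OF linear[of z] Suc.hyps(1)[of R]]
    by (simp only: R poly_shift_ratio_mult mult simp_thms)
qed

lemma realized_fundamental:
  assumes "P \<noteq> 0" "k \<le> n"
  shows "realized n (range Vector) (\<lambda>i. if i \<le> k then poly_shift_ratio P else 1)"
proof (rule realized_polynomial[OF assms(1), where h = "\<lambda>i x. if i \<le> k then x else 1"])
  show "realized n (range Vector) (\<lambda>i. if i \<le> k then poly_shift_ratio [:- z, 1:] else 1)" for z
    by (rule realizedI[OF _ weight_vector_vector_string[OF assms(2), of z]])
      (auto simp: poly_shift_ratio_linear)
qed auto

text \<open>
  The \<open>n\<close>-th exterior power of a covector module is one-dimensional and \<open>T_ii(u)\<close> acts on it by the
  same series for all \<open>i\<close>.
\<close>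

lemma realized_inverse_determinant:
  assumes "P \<noteq> 0"
  shows "realized n UNIV (\<lambda>i. 1 / poly_shift_ratio P)"
proof (rule realized_polynomial[OF assms, where h = "\<lambda>i x. 1 / x"])
  \<comment> \<open>The eigenvalue depends on the largest parameter of the string, which has to be \<open>z\<close>.\<close>
  show "realized n UNIV (\<lambda>i. 1 / poly_shift_ratio [:- z, 1:])" for z
    by (rule realizedI[OF _ weight_vector_covector_string[of n "z + 1 - of_nat n"]])
      (auto simp: inverse_poly_shift_ratio_linear)
qed auto

lemma realized_product:
  assumes "\<And>k. k \<in> {1..m} \<Longrightarrow> P k \<noteq> 0" "m \<le> n"
  shows "realized n (range Vector) (\<lambda>i. \<Prod>k\<in>{i..m}. poly_shift_ratio (P k))"
  using assms
proof (induction m)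
  case 0
  show ?case by (rule realized_cong[OF _ realized_one]) auto
next
  case (Suc m)
  have "realized n (range Vector) (\<lambda>i. (\<Prod>k\<in>{i..m}. poly_shift_ratio (P k))
      * (if i \<le> Suc m then poly_shift_ratio (P (Suc m)) else 1))"
    using Suc by (intro realized_mult realized_fundamental Suc.IH) auto
  then show ?case
    by (rule realized_cong[rotated]) (auto simp: prod.nat_ivl_Suc')
qed

lemma isomorphic_if_realized:
  assumes irr: "irreducible_fin_dim_module scale n V T"
    and hw: "yangian_module.hw_vector scale n V T A v" "v \<noteq> 0"
    and L: "\<And>i. i \<in> {1..n} \<Longrightarrow> fps_to_fls (A i) = L i" "realized n S L"
  shows "\<exists>Fs. set Fs \<subseteq> S \<and>
    isomorphic_to_subquotient n fun_scale (tensor_space n Fs) (tensor_action n Fs) scale V T"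
proof -
  interpret yangian_module scale n V T
    using irr by (simp add: irreducible_fin_dim_module_def)
  obtain Fs f B where Fs: "set Fs \<subseteq> S" and f: "weight_vector n Fs B f"
    and B: "\<And>i. i \<in> {1..n} \<Longrightarrow> fps_to_fls (B i) = L i"
    using L(2) unfolding realized_def by blast
  have "A i = B i" if "i \<in> {1..n}" for i
    using L(1)[OF that] B[OF that] by (metis fps_to_fls_eq_iff)
  then have "hw_vector B v" using hw(1) by (simp add: hw_vector_def)
  then show ?thesis
    using irreducible_subquotient_of_hw_module[OF irr tensor_yangian_module _ hw(2)
        weight_vector_imp_hw_vector[OF f]] f Fs
    by (auto simp: weight_vector_def)
qed

lemma polynomial_module_iff:
  "polynomial_module scale n V T \<longleftrightarrow> (\<exists>Fs. set Fs \<subseteq> range Vector \<and>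
    isomorphic_to_subquotient n fun_scale (tensor_space n Fs) (tensor_action n Fs) scale V T)"
proof -
  have map: "set Fs \<subseteq> range Vector \<longleftrightarrow> (\<exists>zs. Fs = map Vector zs)" for Fs
    by (auto simp: ex_map_conv)
  show ?thesis unfolding polynomial_module_def Let_def map by blast
qed

theorem theorem1p2:
  fixes n :: nat
    and P :: "nat \<Rightarrow> complex poly"
    and An :: "complex fps"
    and scale :: "complex \<Rightarrow> 'v::ab_group_add \<Rightarrow> 'v"
    and \<Psi> :: "'v set"
    and T :: "nat \<Rightarrow> nat \<Rightarrow> nat \<Rightarrow> 'v \<Rightarrow> 'v"
  assumes "n \<ge> 1"
    and "\<And>i. i \<in> {1..<n} \<Longrightarrow> lead_coeff (P i) = 1"
    and "fps_nth An 0 = 1"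
    and "irreducible_fin_dim_module scale n \<Psi> T"
    and "determined_by scale n \<Psi> T An P"
  shows "(polynomial_module scale n \<Psi> T \<longleftrightarrow>
            (\<exists>Q :: complex poly. Q \<noteq> 0 \<and> fps_to_fls An = poly_shift_ratio Q)) \<and>
         (rational_module scale n \<Psi> T \<longleftrightarrow>
            (\<exists>Q :: complex poly fract. Q \<noteq> 0 \<and> fps_to_fls An = ratfun_shift_ratio Q))"
proof -
  interpret yangian_module scale n \<Psi> T
    using assms(4) by (simp add: irreducible_fin_dim_module_def)
  obtain v A where v: "v \<in> \<Psi>" "v \<noteq> 0"
    and raise: "\<forall>i\<in>{1..n}. \<forall>j\<in>{1..n}. i < j \<longrightarrow> (\<forall>r. T i j r v = 0)"
    and A: "\<forall>i\<in>{1..n}. fps_nth (A i) 0 = 1 \<and> (\<forall>r. T i i r v = scale (fps_nth (A i) r) v)"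
    and An: "A n = An"
    and ratio: "\<forall>i\<in>{1..<n}. fps_to_fls (A i) / fps_to_fls (A (Suc i)) = poly_shift_ratio (P i)"
    using assms(5) unfolding determined_by_def by blast
  have hw: "hw_vector A v"
    using v raise A by (simp add: hw_vector_def)
  have P: "P k \<noteq> 0" if "k \<in> {1..n - 1}" for k
  proof -
    have "k \<in> {1..<n}" using that by auto
    then show ?thesis using assms(2)[of k] by auto
  qed
  have weights: "fps_to_fls (A i) = (\<Prod>k\<in>{i..n - 1}. poly_shift_ratio (P k)) * fps_to_fls An"
    if "i \<in> {1..n}" for i
  proof -
    have "i \<le> n" "1 \<le> i" using that by auto
    then show ?thesis
    proof (induction i rule: inc_induct)
      case base
      then show ?case using assms(1) by (simp add: An)
    next
      case (step i)
      have "fps_nth (A (Suc i)) 0 = 1" using A step by auto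
      then have nz: "fps_to_fls (A (Suc i)) \<noteq> 0" by auto
      have "fps_to_fls (A i) / fps_to_fls (A (Suc i)) = poly_shift_ratio (P i)"
        by (intro bspec[OF ratio]) (use step in auto)
      then have "fps_to_fls (A i) = poly_shift_ratio (P i) * fps_to_fls (A (Suc i))"
        by (simp only: nonzero_divide_eq_eq[OF nz])
      also have "\<dots> = (poly_shift_ratio (P i) * (\<Prod>k\<in>{Suc i..n - 1}. poly_shift_ratio (P k)))
          * fps_to_fls An"
        using step by (simp add: mult.assoc)
      also have "poly_shift_ratio (P i) * (\<Prod>k\<in>{Suc i..n - 1}. poly_shift_ratio (P k))
          = (\<Prod>k\<in>{i..n - 1}. poly_shift_ratio (P k))"
        using step by (subst prod.atLeast_Suc_atMost[of i]) auto
      finally show ?case .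
    qed
  qed
  have eigenvalue: "T n n r v = scale (fps_nth An r) v" for r
    using A assms(1) An by auto

  have "polynomial_module scale n \<Psi> T \<longleftrightarrow> (\<exists>Q. Q \<noteq> 0 \<and> fps_to_fls An = poly_shift_ratio Q)"
  proof
    assume "polynomial_module scale n \<Psi> T"
    then obtain zs where "isomorphic_to_subquotient n fun_scale (tensor_space n (map Vector zs))
        (tensor_action n (map Vector zs)) scale \<Psi> T"
      unfolding polynomial_module_def Let_def by blast
    from subquotient_eigenvalue[OF assms(1) this yangian_module_axioms v eigenvalue]
    obtain w where w: "w \<in> words n (length zs)" "An = tensor_series n (map Vector zs) n n w w"
      unfolding length_map by blast
    show "\<exists>Q. Q \<noteq> 0 \<and> fps_to_fls An = poly_shift_ratio Q"
      unfolding w(2) by (rule diagonal_entry_vector[OF assms(1) w(1)])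
  next
    assume "\<exists>Q. Q \<noteq> 0 \<and> fps_to_fls An = poly_shift_ratio Q"
    then obtain Q where Q: "Q \<noteq> 0" "fps_to_fls An = poly_shift_ratio Q" by blast
    have "realized n (range Vector)
        (\<lambda>i. (\<Prod>k\<in>{i..n - 1}. poly_shift_ratio (P k)) * (if i \<le> n then poly_shift_ratio Q else 1))"
      using P by (intro realized_mult realized_product realized_fundamental Q(1)) auto
    then have "realized n (range Vector)
        (\<lambda>i. (\<Prod>k\<in>{i..n - 1}. poly_shift_ratio (P k)) * fps_to_fls An)"
      by (rule realized_cong[rotated]) (auto simp: Q(2))
    from isomorphic_if_realized[OF assms(4) hw v(2) weights this]
    show "polynomial_module scale n \<Psi> T" by (simp add: polynomial_module_iff)
  qed
  moreover have "rational_module scale n \<Psi> T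
      \<longleftrightarrow> (\<exists>Q :: complex poly fract. Q \<noteq> 0 \<and> fps_to_fls An = ratfun_shift_ratio Q)"
  proof
    assume "rational_module scale n \<Psi> T"
    then obtain Fs where "isomorphic_to_subquotient n fun_scale (tensor_space n Fs)
        (tensor_action n Fs) scale \<Psi> T"
      unfolding rational_module_def by blast
    from subquotient_eigenvalue[OF assms(1) this yangian_module_axioms v eigenvalue]
    obtain w where w: "w \<in> words n (length Fs)" "An = tensor_series n Fs n n w w"
      by blast
    obtain Q R where QR: "Q \<noteq> 0" "R \<noteq> 0"
        "fps_to_fls An = poly_shift_ratio Q / poly_shift_ratio R"
      unfolding w(2) using diagonal_entry_factor[OF assms(1) w(1)] by blast
    then have "Fract Q R \<noteq> 0"
      using eq_fract(1)[of R 1 Q 0] by (simp flip: Zero_fract_def)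
    then show "\<exists>Q :: complex poly fract. Q \<noteq> 0 \<and> fps_to_fls An = ratfun_shift_ratio Q"
      unfolding QR(3) ratfun_shift_ratio_Fract[OF QR(1,2), symmetric] by blast
  next
    assume "\<exists>Q :: complex poly fract. Q \<noteq> 0 \<and> fps_to_fls An = ratfun_shift_ratio Q"
    then obtain q :: "complex poly fract" where q: "q \<noteq> 0" "fps_to_fls An = ratfun_shift_ratio q"
      by blast
    obtain Q R where QR: "q = Fract Q R" "R \<noteq> 0" by (cases q) auto
    then have "Q \<noteq> 0"
      using q(1) eq_fract(1)[of R 1 Q 0] by (simp flip: Zero_fract_def)
    have An_eq: "fps_to_fls An = poly_shift_ratio Q * (1 / poly_shift_ratio R)"
      using q(2) QR \<open>Q \<noteq> 0\<close> by (simp add: ratfun_shift_ratio_Fract)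
    have "realized n (range Vector)
        (\<lambda>i. (\<Prod>k\<in>{i..n - 1}. poly_shift_ratio (P k)) * (if i \<le> n then poly_shift_ratio Q else 1))"
      using P by (intro realized_mult realized_product realized_fundamental \<open>Q \<noteq> 0\<close>) auto
    from realized_mult[OF realized_mono[OF subset_UNIV this] realized_inverse_determinant[OF QR(2)]]
    have "realized n UNIV (\<lambda>i. (\<Prod>k\<in>{i..n - 1}. poly_shift_ratio (P k)) * fps_to_fls An)"
      by (rule realized_cong[rotated]) (auto simp: An_eq)
    from isomorphic_if_realized[OF assms(4) hw v(2) weights this]
    show "rational_module scale n \<Psi> T" by (simp add: rational_module_def)
  qed
  ultimately show ?thesis by blast
qed

end
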